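(* Let $(\varepsilon_j)_{j\ge0}$ be a bounded complex sequence with $\varepsilon_j\to c$ as $j\to\infty$, where $c\in\mathbb{C}$ and $|c|\neq 1$, and let $T_\varepsilon=U+D_\varepsilon$ with $D_\varepsilon=\sum_{j\ge0}\varepsilon_j\,|e_j\rangle\langle e_j|$. Then $T_\varepsilon$ is Fredholm with symbol $z+c$, and $$\operatorname{index}(T_\varepsilon)=\operatorname{index}(U+cI)=-\mathbf{1}_{\{|c|<1\}}=-\mathrm{wind}(z+c)=\sum_{j\ge0}\omega_j\bigl(T_{z+c},T_{1/(z+c)}\bigr).$$ In particular the index depends only on the limit $c$ and not otherwise on the sequence $(\varepsilon_j)$; it equals $-1$ when $|c|<1$ and $0$ when $|c|>1$, so it jumps from $-1$ to $0$ as $|c|$ crosses $1$.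
   Context: Let $(e_n)_{n\ge 0}$ be the canonical orthonormal basis of $\ell^2(\mathbb{Z}_{\ge 0})$ (inner product linear in the second argument), and let $U$ be the forward unilateral shift, $Ue_n=e_{n+1}$. $|e_j\rangle\langle e_j|$ denotes the rank-one projection $v\mapsto\langle e_j,v\rangle e_j$. For a smooth function $h$ on the unit circle $\mathbb{S}^1$ with Fourier coefficients $\hat h_k$, $T_h$ denotes the Toeplitz operator on $\ell^2(\mathbb{Z}_{\ge0})\cong H^2(\mathbb{S}^1)$ with matrix entries $\langle e_m,T_he_n\rangle=\hat h_{m-n}$; thus $T_{z+c}=U+cI$. A bounded operator $A$ is said to have symbol $h$ if $A-T_h$ is compact. For bounded operators $X,Y$ and $j\ge0$, $\omega_j(X,Y)=\langle e_j,[X,Y]e_j\rangle$ with $[X,Y]=XY-YX$. For a nowhere-vanishing smooth $h$ on $\mathbb{S}^1$, $\mathrm{wind}(h)=\frac{1}{2\pi i}\oint_{\mathbb{S}^1}h^{-1}\,dh$ is the winding number about the origin. The Fredholm index is $\operatorname{index}(A)=\dim\ker A-\dim\ker A^*$. $\mathbf{1}_{\{|c|<1\}}$ equals $1$ if $|c|<1$ and $0$ otherwise. *)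

theory Defs
  imports "HOL-Complex_Analysis.Complex_Analysis"
begin

section \<open>The Hilbert space of square-summable complex sequences\<close>

typedef ell2 = "{x :: nat \<Rightarrow> complex. summable (\<lambda>n. (cmod (x n))\<^sup>2)}"
  morphisms coord Abs_ell2
  by (rule exI[of _ "\<lambda>_. 0"]) simp

setup_lifting type_definition_ell2

lemma summable_ell2_scale:
  assumes "summable (\<lambda>n. (cmod (x n))\<^sup>2)"
  shows "summable (\<lambda>n. (cmod (a * x n))\<^sup>2)"
  using summable_mult[OF assms, of "(cmod a)\<^sup>2"] by (simp add: norm_mult power_mult_distrib)

lemma summable_ell2_add:
  assumes "summable (\<lambda>n. (cmod (x n))\<^sup>2)" "summable (\<lambda>n. (cmod (y n))\<^sup>2)"
  shows "summable (\<lambda>n. (cmod (x n + y n))\<^sup>2)"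
proof (rule summable_comparison_test)
  show "summable (\<lambda>n. 2 * (cmod (x n))\<^sup>2 + 2 * (cmod (y n))\<^sup>2)"
    using assms by (intro summable_add summable_mult)
  have "(cmod (x n + y n))\<^sup>2 \<le> 2 * (cmod (x n))\<^sup>2 + 2 * (cmod (y n))\<^sup>2" for n
  proof -
    have "(cmod (x n + y n))\<^sup>2 \<le> (cmod (x n) + cmod (y n))\<^sup>2"
      by (intro power_mono norm_triangle_ineq) simp
    also have "\<dots> \<le> 2 * (cmod (x n))\<^sup>2 + 2 * (cmod (y n))\<^sup>2"
      using zero_le_power2[of "cmod (x n) - cmod (y n)"]
      by (simp add: power2_eq_square algebra_simps)
    finally show ?thesis .
  qed
  then show "\<exists>N. \<forall>n\<ge>N. norm ((cmod (x n + y n))\<^sup>2) \<le> 2 * (cmod (x n))\<^sup>2 + 2 * (cmod (y n))\<^sup>2"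
    by simp
qed

lemma summable_ell2_inner:
  assumes "summable (\<lambda>n. (cmod (x n))\<^sup>2)" "summable (\<lambda>n. (cmod (y n))\<^sup>2)"
  shows "summable (\<lambda>n. cnj (x n) * y n)"
proof (rule summable_comparison_test)
  show "summable (\<lambda>n. (cmod (x n))\<^sup>2 + (cmod (y n))\<^sup>2)"
    using assms by (rule summable_add)
  have "cmod (x n) * cmod (y n) \<le> (cmod (x n))\<^sup>2 + (cmod (y n))\<^sup>2" for n
  proof -
    have "2 * (cmod (x n) * cmod (y n)) \<le> (cmod (x n))\<^sup>2 + (cmod (y n))\<^sup>2"
      using zero_le_power2[of "cmod (x n) - cmod (y n)"]
      by (simp add: power2_eq_square algebra_simps)
    moreover have "0 \<le> cmod (x n) * cmod (y n)" by simp
    ultimately show ?thesis by linarith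
  qed
  then show "\<exists>N. \<forall>n\<ge>N. norm (cnj (x n) * y n) \<le> (cmod (x n))\<^sup>2 + (cmod (y n))\<^sup>2"
    by (simp add: norm_mult)
qed

lift_definition scaleC :: "complex \<Rightarrow> ell2 \<Rightarrow> ell2"  (infixr "*\<^sub>C" 75)
  is "\<lambda>a x n. a * x n" by (rule summable_ell2_scale)

definition cinner :: "ell2 \<Rightarrow> ell2 \<Rightarrow> complex"
  where "cinner x y = (\<Sum>n. cnj (coord x n) * coord y n)"

lemma summable_cinner: "summable (\<lambda>n. cnj (coord x n) * coord y n)"
  using coord[of x] coord[of y] by (intro summable_ell2_inner) auto

text \<open>The real part of the complex inner product makes the space a real inner product space.
  This supplies the library's norm, topology and notion of a bounded linear map; all linear
  algebra below is nevertheless over the complex numbers, via \<^const>\<open>scaleC\<close>.\<close>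

instantiation ell2 :: real_inner
begin

lift_definition zero_ell2 :: ell2 is "\<lambda>_. 0" by simp

lift_definition plus_ell2 :: "ell2 \<Rightarrow> ell2 \<Rightarrow> ell2" is "\<lambda>x y n. x n + y n"
  by (rule summable_ell2_add)

lift_definition uminus_ell2 :: "ell2 \<Rightarrow> ell2" is "\<lambda>x n. - x n" by simp

definition minus_ell2 :: "ell2 \<Rightarrow> ell2 \<Rightarrow> ell2" where "x - y = x + - (y :: ell2)"

definition scaleR_ell2 :: "real \<Rightarrow> ell2 \<Rightarrow> ell2" where "scaleR r x = complex_of_real r *\<^sub>C x"

definition inner_ell2 :: "ell2 \<Rightarrow> ell2 \<Rightarrow> real" where "inner x y = Re (cinner x y)"

definition norm_ell2 :: "ell2 \<Rightarrow> real" where "norm x = sqrt (inner x (x :: ell2))"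

definition sgn_ell2 :: "ell2 \<Rightarrow> ell2" where "sgn x = inverse (norm x) *\<^sub>R (x :: ell2)"

definition dist_ell2 :: "ell2 \<Rightarrow> ell2 \<Rightarrow> real" where "dist x y = norm (x - y :: ell2)"

definition uniformity_ell2 :: "(ell2 \<times> ell2) filter"
  where "uniformity_ell2 = (INF e\<in>{0 <..}. principal {(x, y). dist x y < e})"

definition open_ell2 :: "ell2 set \<Rightarrow> bool"
  where "open_ell2 S \<longleftrightarrow> (\<forall>x\<in>S. \<forall>\<^sub>F (x', y) in uniformity. x' = x \<longrightarrow> y \<in> S)"

instance
proof
  fix x y z :: ell2 and r s :: real
  show "x + y + z = x + (y + z)" by transfer (simp add: add.assoc)
  show "x + y = y + x" by transfer (simp add: add.commute)
  show "0 + x = x" by transfer simp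
  show "- x + x = 0" by transfer simp
  show "x - y = x + - y" by (fact minus_ell2_def)
  show "r *\<^sub>R (x + y) = r *\<^sub>R x + r *\<^sub>R y"
    unfolding scaleR_ell2_def by transfer (simp add: algebra_simps)
  show "(r + s) *\<^sub>R x = r *\<^sub>R x + s *\<^sub>R x"
    unfolding scaleR_ell2_def by transfer (simp add: algebra_simps)
  show "r *\<^sub>R s *\<^sub>R x = (r * s) *\<^sub>R x"
    unfolding scaleR_ell2_def by transfer (simp add: algebra_simps)
  show "1 *\<^sub>R x = x" unfolding scaleR_ell2_def by transfer simp
  show "dist x y = norm (x - y)" by (fact dist_ell2_def)
  show "sgn x = inverse (norm x) *\<^sub>R x" by (fact sgn_ell2_def)
  show "uniformity = (INF e\<in>{0 <..}. principal {(x :: ell2, y). dist x y < e})"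
    by (fact uniformity_ell2_def)
  show "open S \<longleftrightarrow> (\<forall>x\<in>S. \<forall>\<^sub>F (x', y) in uniformity. x' = x \<longrightarrow> y \<in> S)" for S :: "ell2 set"
    by (fact open_ell2_def)
  have Re_cinner: "inner u v = (\<Sum>n. Re (cnj (coord u n) * coord v n))" for u v :: ell2
    unfolding inner_ell2_def cinner_def by (rule Re_suminf[OF summable_cinner])
  have summable_Re: "summable (\<lambda>n. Re (cnj (coord u n) * coord v n))" for u v
    by (rule summable_Re[OF summable_cinner])
  show "inner x y = inner y x"
    unfolding Re_cinner by (simp add: mult.commute)
  show "inner (x + y) z = inner x z + inner y z"
    unfolding Re_cinner using suminf_add[OF summable_Re summable_Re, of x z y z]
    by (simp add: plus_ell2.rep_eq algebra_simps)
  show "inner (r *\<^sub>R x) y = r * inner x y"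
    unfolding Re_cinner using suminf_mult[OF summable_Re, of r x y]
    by (simp add: scaleR_ell2_def scaleC.rep_eq algebra_simps)
  have self: "Re (cnj (coord x n) * coord x n) = (cmod (coord x n))\<^sup>2" for n
    by (simp add: cmod_power2) (simp add: power2_eq_square)
  have summable_self: "summable (\<lambda>n. (cmod (coord x n))\<^sup>2)" using coord[of x] by simp
  show "0 \<le> inner x x"
    unfolding Re_cinner self by (rule suminf_nonneg[OF summable_self]) simp
  show "inner x x = 0 \<longleftrightarrow> x = 0"
  proof -
    have "inner x x = 0 \<longleftrightarrow> (\<forall>n. (cmod (coord x n))\<^sup>2 = 0)"
      unfolding Re_cinner self by (rule suminf_eq_zero_iff[OF summable_self]) simp
    also have "\<dots> \<longleftrightarrow> x = 0"
      by (simp add: coord_inject[symmetric] zero_ell2.rep_eq fun_eq_iff)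
    finally show ?thesis .
  qed
  show "norm x = sqrt (inner x x)" by (fact norm_ell2_def)
qed

end

interpretation ell2: vector_space scaleC
  by unfold_locales (transfer; simp add: algebra_simps)+

lift_definition basis_vec :: "nat \<Rightarrow> ell2" is "\<lambda>j n. if n = j then 1 else 0"
proof -
  fix j :: nat
  show "summable (\<lambda>n. (cmod (if n = j then 1 else 0))\<^sup>2)"
    by (rule summable_finite[of "{j}"]) auto
qed

section \<open>Bounded operators, Fredholm operators and the index\<close>

definition bounded_clinear :: "(ell2 \<Rightarrow> ell2) \<Rightarrow> bool"
  where "bounded_clinear A \<longleftrightarrow> bounded_linear A \<and> (\<forall>a x. A (a *\<^sub>C x) = a *\<^sub>C A x)"

definition compact_operator :: "(ell2 \<Rightarrow> ell2) \<Rightarrow> bool"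
  where "compact_operator K \<longleftrightarrow> bounded_clinear K \<and> compact (closure (K ` cball 0 1))"

definition adj :: "(ell2 \<Rightarrow> ell2) \<Rightarrow> ell2 \<Rightarrow> ell2"
  where "adj A = (THE B. \<forall>x y. cinner (B x) y = cinner x (A y))"

definition kernel :: "(ell2 \<Rightarrow> ell2) \<Rightarrow> ell2 set"
  where "kernel A = {x. A x = 0}"

definition finite_cdim :: "ell2 set \<Rightarrow> bool"
  where "finite_cdim V \<longleftrightarrow> (\<exists>B. finite B \<and> ell2.span B = V)"

definition fredholm :: "(ell2 \<Rightarrow> ell2) \<Rightarrow> bool"
  where "fredholm A \<longleftrightarrow> bounded_clinear A \<and> closed (range A) \<and>
    finite_cdim (kernel A) \<and> finite_cdim (kernel (adj A))"

definition fredholm_index :: "(ell2 \<Rightarrow> ell2) \<Rightarrow> int"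
  where "fredholm_index A = int (ell2.dim (kernel A)) - int (ell2.dim (kernel (adj A)))"

section \<open>Shift, diagonal and Toeplitz operators\<close>

lift_definition shift :: "ell2 \<Rightarrow> ell2"
  is "\<lambda>x n. case n of 0 \<Rightarrow> 0 | Suc m \<Rightarrow> x m"
  by (subst summable_Suc_iff[symmetric]) simp

lemma shift_basis_vec: "shift (basis_vec n) = basis_vec (Suc n)"
  by transfer (auto simp: fun_eq_iff split: nat.split)

definition basis_proj :: "nat \<Rightarrow> ell2 \<Rightarrow> ell2"
  where "basis_proj j v = cinner (basis_vec j) v *\<^sub>C basis_vec j"

text \<open>The series of rank-one operators is summed in the strong operator topology; it does not
  converge in operator norm unless the coefficients tend to \<open>0\<close>.\<close>

definition diag_operator :: "(nat \<Rightarrow> complex) \<Rightarrow> ell2 \<Rightarrow> ell2"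
  where "diag_operator \<epsilon> v = (\<Sum>j. \<epsilon> j *\<^sub>C basis_proj j v)"

definition perturbed_shift :: "(nat \<Rightarrow> complex) \<Rightarrow> ell2 \<Rightarrow> ell2"
  where "perturbed_shift \<epsilon> v = shift v + diag_operator \<epsilon> v"

text \<open>A function on the unit circle is represented by a function on the complex plane of which
  only the values on the circle are used. The operator \<open>toeplitz h\<close> is determined by its matrix
  entries; it exists when \<open>h\<close> is smooth on the circle and is unspecified when no bounded operator
  has these entries.\<close>

definition fourier_coeff :: "(complex \<Rightarrow> complex) \<Rightarrow> int \<Rightarrow> complex"
  where "fourier_coeff h k =
    integral {0..2 * pi} (\<lambda>t. h (cis t) * cis (- (of_int k * t))) / of_real (2 * pi)"

definition toeplitz :: "(complex \<Rightarrow> complex) \<Rightarrow> ell2 \<Rightarrow> ell2"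
  where "toeplitz h = (THE A. bounded_clinear A \<and>
    (\<forall>m n. cinner (basis_vec m) (A (basis_vec n)) = fourier_coeff h (int m - int n)))"

definition has_symbol :: "(ell2 \<Rightarrow> ell2) \<Rightarrow> (complex \<Rightarrow> complex) \<Rightarrow> bool"
  where "has_symbol A h \<longleftrightarrow> bounded_clinear A \<and> compact_operator (\<lambda>v. A v - toeplitz h v)"

definition commutator :: "(ell2 \<Rightarrow> ell2) \<Rightarrow> (ell2 \<Rightarrow> ell2) \<Rightarrow> ell2 \<Rightarrow> ell2"
  where "commutator X Y v = X (Y v) - Y (X v)"

definition omega :: "nat \<Rightarrow> (ell2 \<Rightarrow> ell2) \<Rightarrow> (ell2 \<Rightarrow> ell2) \<Rightarrow> complex"
  where "omega j X Y = cinner (basis_vec j) (commutator X Y (basis_vec j))"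

text \<open>The integral of \<open>h\<inverse> dh\<close> over the circle is the contour integral of \<open>1 / w\<close> along the image
  of the circle under \<open>h\<close>. This is meant for \<open>h\<close> smooth and nowhere vanishing on the circle.\<close>

definition wind :: "(complex \<Rightarrow> complex) \<Rightarrow> complex"
  where "wind h = contour_integral (h \<circ> circlepath 0 1) (\<lambda>w. 1 / w) / (2 * of_real pi * \<i>)"

end

theory Submission imports Defs
begin

text \<open>Off finitely many coordinates, \<open>T\<^sub>\<epsilon>\<close> is bounded below, because there the shift dominates
  the diagonal (\<open>|c| < 1\<close>) or the diagonal dominates the shift (\<open>|c| > 1\<close>); hence its range is
  closed. Both kernels are solution sets of first-order recurrences, so they are at most
  one-dimensional and can be read off. For \<open>|c| < 1\<close> only the kernel of the adjoint is nonzero. For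
  \<open>|c| > 1\<close> the two kernels are both zero, or both one-dimensional if some \<open>\<epsilon>\<^sub>j\<close> vanishes. In the
  sum of the \<open>\<omega>\<^sub>j\<close> only \<open>j = 0\<close> contributes, with minus the Fourier coefficient of
  \<open>1 / (z + c)\<close> at \<open>-1\<close>.\<close>

section \<open>Coordinates and the norm\<close>

text \<open>No stability theorem for the index under compact perturbations enters: both kernels are
  solved explicitly for every admissible sequence, so \<open>U + cI\<close> is the constant-sequence
  instance of the same computation, and independence of the sequence is read off the resulting
  formula. In the kernel and range arguments, |c| \<noteq> 1 acts through a number r strictly
  between |c| and 1, which turns the limit into a uniform geometric estimate from some index on. The
  finitely many earlier entries are arbitrary, and they are the obstacle. They can spoil the lower
  bound, so the image of a subspace of finite codimension is shown closed first and then enlarged by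
  one line at a time. They can also vanish, which for |c| > 1 creates a vector in each of the two
  kernels and leaves the index unchanged. Since \<open>adj\<close> and \<open>toeplitz\<close> are
  definite descriptions, each is computed by exhibiting a candidate and proving uniqueness by means
  of basis vectors.\<close>

lemma ell2_eqI: "(\<And>n. coord x n = coord y n) \<Longrightarrow> x = y"
  by (metis coord_inject ext)

lemma coord_minus: "coord (x - y) n = coord x n - coord y n"
  unfolding minus_ell2_def plus_ell2.rep_eq uminus_ell2.rep_eq by simp

lemma coord_scaleR: "coord (r *\<^sub>R x) n = of_real r * coord x n"
  by (simp add: scaleR_ell2_def scaleC.rep_eq)

lemmas coord_simps = zero_ell2.rep_eq plus_ell2.rep_eq uminus_ell2.rep_eq coord_minus
  scaleC.rep_eq coord_scaleR basis_vec.rep_eq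

lemma coord_shift_0 [simp]: "coord (shift x) 0 = 0"
  and coord_shift_Suc [simp]: "coord (shift x) (Suc n) = coord x n"
  by (simp_all add: shift.rep_eq)

lemma coord_sum: "coord (sum f S) n = (\<Sum>i\<in>S. coord (f i) n)"
  by (induction S rule: infinite_finite_induct) (simp_all add: coord_simps)

lemma summable_coord: "summable (\<lambda>n. (cmod (coord x n))\<^sup>2)"
  using coord[of x] by simp

lemma norm_ell2_power2: "(norm x)\<^sup>2 = (\<Sum>n. (cmod (coord x n))\<^sup>2)"
proof -
  have self: "Re (cnj z * z) = (cmod z)\<^sup>2" for z
    by (simp add: cmod_power2) (simp add: power2_eq_square)
  have "(norm x)\<^sup>2 = Re (cinner x x)"
    unfolding inner_ell2_def[symmetric] by (rule power2_norm_eq_inner)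
  also have "\<dots> = (\<Sum>n. Re (cnj (coord x n) * coord x n))"
    unfolding cinner_def by (rule Re_suminf[OF summable_cinner])
  also have "\<dots> = (\<Sum>n. (cmod (coord x n))\<^sup>2)"
    by (simp only: self)
  finally show ?thesis .
qed

lemma sum_coord_le_norm: "(\<Sum>n<M. (cmod (coord x n))\<^sup>2) \<le> (norm x)\<^sup>2"
  unfolding norm_ell2_power2 by (rule sum_le_suminf[OF summable_coord]) auto

lemma norm_ell2_leI:
  assumes "\<And>M. (\<Sum>n<M. (cmod (coord x n))\<^sup>2) \<le> e\<^sup>2" and "0 \<le> e"
  shows "norm x \<le> e"
proof (rule power2_le_imp_le)
  show "(norm x)\<^sup>2 \<le> e\<^sup>2"
    unfolding norm_ell2_power2 by (rule suminf_le_const[OF summable_coord assms(1)])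
qed (rule assms)

lemma norm_ell2_mono:
  assumes "\<And>n. cmod (coord x n) \<le> r * cmod (coord y n)" and "0 \<le> r"
  shows "norm x \<le> r * norm y"
proof (rule norm_ell2_leI)
  fix M
  have "(\<Sum>n<M. (cmod (coord x n))\<^sup>2) \<le> (\<Sum>n<M. r\<^sup>2 * (cmod (coord y n))\<^sup>2)"
  proof (rule sum_mono)
    fix n
    show "(cmod (coord x n))\<^sup>2 \<le> r\<^sup>2 * (cmod (coord y n))\<^sup>2"
      using power_mono[OF assms(1), of n 2] by (simp add: power_mult_distrib)
  qed
  also have "\<dots> \<le> (r * norm y)\<^sup>2"
    unfolding sum_distrib_left[symmetric] power_mult_distrib
    by (intro mult_left_mono sum_coord_le_norm) auto
  finally show "(\<Sum>n<M. (cmod (coord x n))\<^sup>2) \<le> (r * norm y)\<^sup>2" .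
qed (use assms in simp)

lemma cmod_coord_le_norm: "cmod (coord x n) \<le> norm x"
proof (rule power2_le_imp_le)
  have "(cmod (coord x n))\<^sup>2 \<le> (\<Sum>i<Suc n. (cmod (coord x i))\<^sup>2)"
    by (rule member_le_sum) auto
  then show "(cmod (coord x n))\<^sup>2 \<le> (norm x)\<^sup>2"
    using sum_coord_le_norm[where M = "Suc n" and x = x] by linarith
qed simp

lemma coord_tendsto_0: "coord x \<longlonglongrightarrow> 0"
  using tendsto_real_sqrt[OF summable_LIMSEQ_zero[OF summable_coord[of x]]]
  by (simp add: tendsto_norm_zero_iff)

lemma norm_scaleC: "norm (a *\<^sub>C x) = cmod a * norm x"
proof (rule power2_eq_imp_eq)
  show "(norm (a *\<^sub>C x))\<^sup>2 = (cmod a * norm x)\<^sup>2"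
    using suminf_mult[OF summable_coord, of "(cmod a)\<^sup>2" x]
    by (simp add: norm_ell2_power2 power_mult_distrib scaleC.rep_eq norm_mult)
qed auto

lemma norm_shift: "norm (shift x) = norm x"
proof (rule power2_eq_imp_eq)
  show "(norm (shift x))\<^sup>2 = (norm x)\<^sup>2"
    using suminf_split_head[OF summable_coord[of "shift x"]] by (simp add: norm_ell2_power2)
qed auto

lemma bounded_linear_coord: "bounded_linear (\<lambda>x. coord x n)"
  by (rule bounded_linear_intro[where K = 1])
    (auto simp: coord_simps cmod_coord_le_norm scaleR_conv_of_real)

lemmas tendsto_coord = bounded_linear.tendsto[OF bounded_linear_coord]

lemma bounded_linear_scaleC: "bounded_linear ((*\<^sub>C) a)"
  by (rule bounded_linear_intro[where K = "cmod a"])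
    (auto simp: norm_scaleC mult.commute coord_simps algebra_simps intro!: ell2_eqI)

lemma bounded_linear_scaleC_left: "bounded_linear (\<lambda>a. a *\<^sub>C x)"
  by (rule bounded_linear_intro[where K = "norm x"])
    (auto simp: norm_scaleC mult.commute coord_simps algebra_simps scaleR_conv_of_real
      intro!: ell2_eqI)

lemma cinner_basis_vec_left: "cinner (basis_vec j) x = coord x j"
proof -
  have "(\<Sum>n. cnj (coord (basis_vec j) n) * coord x n)
      = (\<Sum>n\<in>{j}. cnj (coord (basis_vec j) n) * coord x n)"
    by (rule suminf_finite) (auto simp: basis_vec.rep_eq)
  then show ?thesis by (simp add: cinner_def basis_vec.rep_eq)
qed

lemma cinner_basis_vec_right: "cinner x (basis_vec j) = cnj (coord x j)"
proof -
  have "(\<Sum>n. cnj (coord x n) * coord (basis_vec j) n)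
      = (\<Sum>n\<in>{j}. cnj (coord x n) * coord (basis_vec j) n)"
    by (rule suminf_finite) (auto simp: basis_vec.rep_eq)
  then show ?thesis by (simp add: cinner_def basis_vec.rep_eq)
qed

text \<open>Coordinates of a Cauchy sequence converge; what remains is that the coordinatewise limit
  is square-summable and is also the limit in norm. Completeness serves the closed range,
  compactness via total boundedness, and absolutely convergent operator series.\<close>

instance ell2 :: banach
proof
  fix X :: "nat \<Rightarrow> ell2" assume X: "Cauchy X"
  have "Cauchy (\<lambda>k. coord (X k) n)" for n
    using bounded_linear.Cauchy[OF bounded_linear_coord X] .
  then have "\<exists>l. \<forall>n. (\<lambda>k. coord (X k) n) \<longlonglongrightarrow> l n"
    by (meson Cauchy_convergent_iff convergent_def)
  then obtain l where l: "\<And>n. (\<lambda>k. coord (X k) n) \<longlonglongrightarrow> l n" by blast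
  \<comment> \<open>The Cauchy bound on a finite truncation survives k \<rightarrow> \<infinity>.
    Being uniform in \<open>M\<close>, it yields both square-summability of \<open>l\<close> and
    norm convergence.\<close>
  have tail: "(\<Sum>n<M. (cmod (coord (X m) n - l n))\<^sup>2) \<le> e\<^sup>2"
    if "\<And>m k. m \<ge> N \<Longrightarrow> k \<ge> N \<Longrightarrow> norm (X m - X k) < e" "m \<ge> N" for e N m M
  proof (rule Lim_bounded)
    show "(\<lambda>k. \<Sum>n<M. (cmod (coord (X m) n - coord (X k) n))\<^sup>2)
        \<longlonglongrightarrow> (\<Sum>n<M. (cmod (coord (X m) n - l n))\<^sup>2)"
      by (intro tendsto_intros l)
    show "\<forall>k\<ge>N. (\<Sum>n<M. (cmod (coord (X m) n - coord (X k) n))\<^sup>2) \<le> e\<^sup>2"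
    proof (intro allI impI)
      fix k assume "k \<ge> N"
      with that have "norm (X m - X k) < e" by blast
      then have "(norm (X m - X k))\<^sup>2 \<le> e\<^sup>2"
        by (intro power_mono) auto
      then show "(\<Sum>n<M. (cmod (coord (X m) n - coord (X k) n))\<^sup>2) \<le> e\<^sup>2"
        using sum_coord_le_norm[where x = "X m - X k" and M = M] by (simp add: coord_minus)
    qed
  qed
  have Cauchy_norm: "\<exists>N. \<forall>m\<ge>N. \<forall>k\<ge>N. norm (X m - X k) < e" if "0 < e" for e
    using X that by (simp add: Cauchy_iff)
  have "summable (\<lambda>n. (cmod (l n))\<^sup>2)"
  proof -
    obtain N where N: "\<And>m k. m \<ge> N \<Longrightarrow> k \<ge> N \<Longrightarrow> norm (X m - X k) < 1"
      using Cauchy_norm[of 1] by auto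
    have "summable (\<lambda>n. (cmod (coord (X N) n - l n))\<^sup>2)"
      by (rule summableI_nonneg_bounded[where x = "1\<^sup>2"]) (use tail[OF N, of N] in auto)
    \<comment> \<open>\<open>l\<close> is recovered as \<open>X N - (X N - l)\<close>.\<close>
    from summable_ell2_add[OF summable_coord[of "X N"] summable_ell2_scale[OF this, of "-1"]]
    show ?thesis by simp
  qed
  then have coord_L: "coord (Abs_ell2 l) = l"
    by (simp add: Abs_ell2_inverse)
  have "X \<longlonglongrightarrow> Abs_ell2 l"
  proof (rule LIMSEQ_I)
    fix r :: real assume r: "0 < r"
    then obtain N where N: "\<And>m k. m \<ge> N \<Longrightarrow> k \<ge> N \<Longrightarrow> norm (X m - X k) < r / 2"
      using Cauchy_norm[of "r / 2"] by auto
    have "norm (X m - Abs_ell2 l) \<le> r / 2" if "m \<ge> N" for m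
      using tail[OF N that] r by (intro norm_ell2_leI) (auto simp: coord_minus coord_L)
    then show "\<exists>N. \<forall>n\<ge>N. norm (X n - Abs_ell2 l) < r"
      using r by (intro exI[of _ N]) fastforce
  qed
  then show "convergent X" by (auto simp: convergent_def)
qed

text \<open>The squared norm of the remainder is the tail of a convergent series. Uniqueness of an
  operator with a given matrix and the value of the strong-operator series
  \<open>diag_operator\<close> both rest on this.\<close>

lemma basis_expansion: "(\<lambda>j. coord x j *\<^sub>C basis_vec j) sums x"
  unfolding sums_def
proof (rule LIMSEQ_I)
  fix r :: real assume r: "0 < r"
  have "(\<lambda>M. \<Sum>n<M. (cmod (coord x n))\<^sup>2) \<longlonglongrightarrow> (norm x)\<^sup>2"
    using summable_LIMSEQ[OF summable_coord] by (simp add: norm_ell2_power2)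
  then obtain N where N: "\<And>M. M \<ge> N \<Longrightarrow> norm ((\<Sum>n<M. (cmod (coord x n))\<^sup>2) - (norm x)\<^sup>2) < r\<^sup>2"
    using LIMSEQ_D[of _ "(norm x)\<^sup>2" "r\<^sup>2"] r by (auto simp: dist_norm)
  have "norm ((\<Sum>j<M. coord x j *\<^sub>C basis_vec j) - x) < r" if "M \<ge> N" for M
  proof (rule power2_less_imp_less)
    define y where "y = (\<Sum>j<M. coord x j *\<^sub>C basis_vec j) - x"
    have y: "coord y n = (if n < M then 0 else - coord x n)" for n
    proof -
      have "(\<Sum>j<M. coord x j * (if n = j then 1 else 0)) = (\<Sum>j<M. if j = n then coord x j else 0)"
        by (rule sum.cong) auto
      then show ?thesis by (simp add: y_def coord_simps coord_sum)
    qed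
    have "(norm y)\<^sup>2 = (\<Sum>n. (cmod (coord y (n + M)))\<^sup>2) + (\<Sum>n<M. (cmod (coord y n))\<^sup>2)"
      unfolding norm_ell2_power2 by (rule suminf_split_initial_segment[OF summable_coord])
    also have "\<dots> = (\<Sum>n. (cmod (coord x (n + M)))\<^sup>2)" by (simp add: y)
    also have "\<dots> = (norm x)\<^sup>2 - (\<Sum>n<M. (cmod (coord x n))\<^sup>2)"
      unfolding norm_ell2_power2
      using suminf_split_initial_segment[OF summable_coord[of x], of M] by simp
    also have "\<dots> < r\<^sup>2" using N[OF that] by auto
    finally show "(norm ((\<Sum>j<M. coord x j *\<^sub>C basis_vec j) - x))\<^sup>2 < r\<^sup>2" by (simp add: y_def)
  qed (use r in simp)
  then show "\<exists>N. \<forall>n\<ge>N. norm ((\<Sum>j<n. coord x j *\<^sub>C basis_vec j) - x) < r" by blast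
qed

section \<open>Bounded operators\<close>

lemma bounded_clinearI:
  assumes "\<And>x y. A (x + y) = A x + A y" and "\<And>a x. A (a *\<^sub>C x) = a *\<^sub>C A x"
    and "\<And>x. norm (A x) \<le> K * norm x"
  shows "bounded_clinear A"
  unfolding bounded_clinear_def
  using assms by (auto intro!: bounded_linear_intro[where K = K] simp: scaleR_ell2_def mult.commute)

lemma bounded_clinear_add:
  assumes "bounded_clinear A" "bounded_clinear B"
  shows "bounded_clinear (\<lambda>x. A x + B x)"
  using assms by (auto simp: bounded_clinear_def ell2.scale_right_distrib intro: bounded_linear_add)

lemma bounded_clinear_scaleC: "bounded_clinear ((*\<^sub>C) a)"
  by (simp add: bounded_clinear_def bounded_linear_scaleC mult.commute)

lemma bounded_clinear_shift: "bounded_clinear shift"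
  by (rule bounded_clinearI[where K = 1])
    (auto simp: norm_shift shift.rep_eq coord_simps intro!: ell2_eqI split: nat.split)

lemma bounded_clinear_eqI:
  assumes "bounded_clinear A" "bounded_clinear B" "\<And>n. A (basis_vec n) = B (basis_vec n)"
  shows "A = B"
proof
  fix x
  have "(\<lambda>j. C (coord x j *\<^sub>C basis_vec j)) sums C x" if "bounded_clinear C" for C
    using that by (intro bounded_linear.sums[OF _ basis_expansion]) (simp add: bounded_clinear_def)
  from this[OF assms(1)] this[OF assms(2)] show "A x = B x"
    using assms by (simp add: bounded_clinear_def sums_unique2)
qed

text \<open>Pairing with basis vectors recovers every coordinate, which gives the uniqueness that
  the definite description in \<open>adj\<close> requires.\<close>

lemma adj_eqI:
  assumes "\<And>x y. cinner (B x) y = cinner x (A y)"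
  shows "adj A = B"
  unfolding adj_def
proof (rule the_equality)
  show "\<forall>x y. cinner (B x) y = cinner x (A y)" using assms by blast
  fix C assume C: "\<forall>x y. cinner (C x) y = cinner x (A y)"
  have "coord (C x) n = coord (B x) n" for x n
  proof -
    have "cinner (C x) (basis_vec n) = cinner (B x) (basis_vec n)" using C assms by simp
    then show ?thesis by (simp add: cinner_basis_vec_right)
  qed
  then show "C = B" by (auto intro: ell2_eqI)
qed

text \<open>Boundedness of \<epsilon> puts the pointwise product into the space; the defining series
  is then the basis expansion of that vector.\<close>

lemma coord_diag_operator:
  assumes "bounded (range \<epsilon>)"
  shows "coord (diag_operator \<epsilon> x) n = \<epsilon> n * coord x n"
proof -
  obtain K where K: "\<And>n. cmod (\<epsilon> n) \<le> K"
    using assms by (auto simp: bounded_iff)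
  have "summable (\<lambda>n. (cmod (\<epsilon> n * coord x n))\<^sup>2)"
  proof (rule summable_comparison_test)
    show "summable (\<lambda>n. K\<^sup>2 * (cmod (coord x n))\<^sup>2)"
      by (intro summable_mult summable_coord)
    show "\<exists>N. \<forall>n\<ge>N. norm ((cmod (\<epsilon> n * coord x n))\<^sup>2) \<le> K\<^sup>2 * (cmod (coord x n))\<^sup>2"
      by (auto simp: norm_mult power_mult_distrib intro!: mult_right_mono power_mono K)
  qed
  then have w: "coord (Abs_ell2 (\<lambda>n. \<epsilon> n * coord x n)) = (\<lambda>n. \<epsilon> n * coord x n)"
    by (simp add: Abs_ell2_inverse)
  have "(\<lambda>j. \<epsilon> j *\<^sub>C basis_proj j x) sums Abs_ell2 (\<lambda>n. \<epsilon> n * coord x n)"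
    using basis_expansion[of "Abs_ell2 (\<lambda>n. \<epsilon> n * coord x n)"]
    by (simp add: w basis_proj_def cinner_basis_vec_left)
  then show ?thesis
    by (simp add: diag_operator_def sums_iff w)
qed

lemma bounded_clinear_diag_operator:
  assumes "bounded (range \<epsilon>)"
  shows "bounded_clinear (diag_operator \<epsilon>)"
proof -
  obtain K where K: "\<And>n. cmod (\<epsilon> n) \<le> K"
    using assms by (auto simp: bounded_iff)
  then have "0 \<le> K" using norm_ge_zero order_trans by blast
  then have "norm (diag_operator \<epsilon> x) \<le> K * norm x" for x
    by (intro norm_ell2_mono)
      (auto simp: coord_diag_operator[OF assms] norm_mult intro!: mult_right_mono K)
  then show ?thesis
    by (intro bounded_clinearI)
      (auto simp: coord_diag_operator[OF assms] coord_simps algebra_simps intro!: ell2_eqI)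
qed

lemma bounded_clinear_perturbed_shift:
  "bounded (range \<epsilon>) \<Longrightarrow> bounded_clinear (perturbed_shift \<epsilon>)"
  unfolding perturbed_shift_def
  by (intro bounded_clinear_add bounded_clinear_shift bounded_clinear_diag_operator)

text \<open>Makes \<open>U + cI\<close> an instance of the general index computation.\<close>

lemma perturbed_shift_const: "perturbed_shift (\<lambda>_. c) = (\<lambda>x. shift x + c *\<^sub>C x)"
  unfolding perturbed_shift_def
  by (intro ext ell2_eqI) (auto simp: coord_simps coord_diag_operator)

section \<open>Kernels\<close>

text \<open>The adjoint of \<open>shift\<close>; its powers also carry the negative Fourier modes of
  Toeplitz operators.\<close>

lift_definition backshift :: "ell2 \<Rightarrow> ell2" is "\<lambda>x n. x (Suc n)"
  by (simp add: summable_Suc_iff[of "\<lambda>n. (cmod (_ n))\<^sup>2"])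

lemma norm_backshift_le: "norm (backshift x) \<le> norm x"
proof (rule norm_ell2_leI)
  fix M
  have "(\<Sum>n<M. (cmod (coord (backshift x) n))\<^sup>2) \<le> (\<Sum>n<Suc M. (cmod (coord x n))\<^sup>2)"
    by (simp add: backshift.rep_eq sum.lessThan_Suc_shift del: sum.lessThan_Suc)
  also have "\<dots> \<le> (norm x)\<^sup>2" by (rule sum_coord_le_norm)
  finally show "(\<Sum>n<M. (cmod (coord (backshift x) n))\<^sup>2) \<le> (norm x)\<^sup>2" .
qed simp

lemma bounded_clinear_backshift: "bounded_clinear backshift"
  by (rule bounded_clinearI[where K = 1])
    (auto simp: norm_backshift_le backshift.rep_eq coord_simps intro!: ell2_eqI)

lemma cinner_add_left: "cinner (x + y) z = cinner x z + cinner y z"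
  unfolding cinner_def using suminf_add[OF summable_cinner summable_cinner, of x z y z]
  by (simp add: coord_simps algebra_simps)

lemma cinner_add_right: "cinner x (y + z) = cinner x y + cinner x z"
  unfolding cinner_def using suminf_add[OF summable_cinner summable_cinner, of x y x z]
  by (simp add: coord_simps algebra_simps)

lemma cinner_shift: "cinner x (shift y) = cinner (backshift x) y"
  unfolding cinner_def using suminf_split_head[OF summable_cinner, of x "shift y"]
  by (simp add: backshift.rep_eq)

lemma adj_perturbed_shift:
  assumes "bounded (range \<epsilon>)"
  shows "adj (perturbed_shift \<epsilon>) = (\<lambda>x. backshift x + diag_operator (\<lambda>n. cnj (\<epsilon> n)) x)"
proof (rule adj_eqI)
  fix x y
  have "bounded (range (\<lambda>n. cnj (\<epsilon> n)))"
    using assms by (auto simp: bounded_iff)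
  then have "cinner (diag_operator (\<lambda>n. cnj (\<epsilon> n)) x) y = cinner x (diag_operator \<epsilon> y)"
    by (simp add: cinner_def coord_diag_operator assms ac_simps)
  then show "cinner (backshift x + diag_operator (\<lambda>n. cnj (\<epsilon> n)) x) y
      = cinner x (perturbed_shift \<epsilon> y)"
    by (simp add: perturbed_shift_def cinner_add_left cinner_add_right cinner_shift)
qed

text \<open>The recurrence is left in backward form, expressing coordinate n by coordinate n + 1,
  because \<epsilon> may vanish and cannot be divided by. A zero of \<epsilon> therefore kills all
  coordinates before it.\<close>

lemma kernel_perturbed_shift:
  assumes "bounded (range \<epsilon>)"
  shows "kernel (perturbed_shift \<epsilon>) =
    {x. \<epsilon> 0 * coord x 0 = 0 \<and> (\<forall>n. coord x n = - \<epsilon> (Suc n) * coord x (Suc n))}"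
proof -
  have "perturbed_shift \<epsilon> x = 0 \<longleftrightarrow> (\<forall>n. coord (perturbed_shift \<epsilon> x) n = 0)" for x
    by (auto simp: zero_ell2.rep_eq intro: ell2_eqI)
  also have "\<dots> x \<longleftrightarrow> coord (perturbed_shift \<epsilon> x) 0 = 0
      \<and> (\<forall>n. coord (perturbed_shift \<epsilon> x) (Suc n) = 0)" for x
    by (metis not0_implies_Suc)
  finally show ?thesis
    by (simp add: kernel_def perturbed_shift_def coord_simps coord_diag_operator[OF assms]
        eq_neg_iff_add_eq_0[symmetric])
qed

lemma kernel_adj_perturbed_shift:
  assumes "bounded (range \<epsilon>)"
  shows "kernel (adj (perturbed_shift \<epsilon>)) = {x. \<forall>n. coord x (Suc n) = - cnj (\<epsilon> n) * coord x n}"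
proof -
  have b: "bounded (range (\<lambda>n. cnj (\<epsilon> n)))"
    using assms by (auto simp: bounded_iff)
  have "y = 0 \<longleftrightarrow> (\<forall>n. coord y n = 0)" for y
    by (auto simp: zero_ell2.rep_eq intro: ell2_eqI)
  then show ?thesis
    by (auto simp: kernel_def adj_perturbed_shift[OF assms] coord_simps coord_diag_operator[OF b]
        eq_neg_iff_add_eq_0[symmetric] backshift.rep_eq)
qed

lemma summable_square_ratio:
  fixes u :: "nat \<Rightarrow> complex"
  assumes "r < 1" "0 \<le> r" and "\<And>n. n \<ge> N \<Longrightarrow> cmod (u (Suc n)) \<le> r * cmod (u n)"
  shows "summable (\<lambda>n. (cmod (u n))\<^sup>2)"
proof (rule summable_ratio_test)
  show "r\<^sup>2 < 1" using assms by (simp add: power_less_one_iff)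
  show "norm ((cmod (u (Suc n)))\<^sup>2) \<le> r\<^sup>2 * norm ((cmod (u n))\<^sup>2)" if "n \<ge> N" for n
    using power_mono[OF assms(3)[OF that], of 2] by (simp add: power_mult_distrib)
qed

text \<open>Coordinates tend to 0, so a modulus that never decreases is bounded by 0. This excludes
  kernel vectors whose recurrence does not decay.\<close>

lemma coord_eq_0_of_nondecreasing:
  assumes "\<And>n. n \<ge> N \<Longrightarrow> cmod (coord x n) \<le> cmod (coord x (Suc n))" and "n \<ge> N"
  shows "coord x n = 0"
proof -
  have "cmod (coord x n) \<le> cmod (coord x m)" if "n \<le> m" for m
    using that by (induction m rule: dec_induct) (use assms in \<open>auto intro: order_trans\<close>)
  then have "cmod (coord x n) \<le> 0"
    by (intro tendsto_lowerbound[OF tendsto_norm_zero[OF coord_tendsto_0[of x]]])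
      (auto intro!: eventually_sequentiallyI)
  then show ?thesis by simp
qed

text \<open>The forward recurrence always has a one-dimensional solution space; only
  square-summability is in question. The disjunction covers two sources of it: geometric decay for
  |c| < 1, and a solution that is finitely supported because some \<epsilon> vanishes.\<close>

lemma kernel_adj_perturbed_shift_span:
  assumes "bounded (range \<epsilon>)" and "r < 1" "0 \<le> r"
    and "\<And>n. n \<ge> N \<Longrightarrow> cmod (\<epsilon> n) \<le> r \<or> (\<exists>k\<le>n. \<epsilon> k = 0)"
  shows "\<exists>u. u \<noteq> 0 \<and> kernel (adj (perturbed_shift \<epsilon>)) = ell2.span {u}"
proof -
  \<comment> \<open>The solution of the recurrence with initial value 1.\<close>
  define u where "u n = (\<Prod>j<n. - cnj (\<epsilon> j))" for n
  have "summable (\<lambda>n. (cmod (u n))\<^sup>2)"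
  proof (rule summable_square_ratio[OF assms(2,3)])
    fix n assume n: "n \<ge> N"
    show "cmod (u (Suc n)) \<le> r * cmod (u n)"
    proof (cases "\<exists>k\<le>n. \<epsilon> k = 0")
      case True
      then have "u (Suc n) = 0" by (auto simp: u_def less_Suc_eq_le simp del: prod.lessThan_Suc)
      then show ?thesis using assms(3) by simp
    next
      case False
      then show ?thesis using assms(4)[OF n]
        by (auto simp: u_def norm_mult mult.commute intro!: mult_right_mono)
    qed
  qed
  then have u: "coord (Abs_ell2 u) = u" by (simp add: Abs_ell2_inverse)
  have "coord (Abs_ell2 u) 0 = 1" by (simp add: u) (simp add: u_def)
  then have "Abs_ell2 u \<noteq> 0" by (auto simp: zero_ell2.rep_eq)
  moreover have "kernel (adj (perturbed_shift \<epsilon>)) = range (\<lambda>a. a *\<^sub>C Abs_ell2 u)"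
  proof (intro equalityI subsetI)
    fix x assume "x \<in> kernel (adj (perturbed_shift \<epsilon>))"
    then have "coord x n = coord x 0 * u n" for n
      by (induction n) (simp_all add: kernel_adj_perturbed_shift[OF assms(1)] u_def)
    then have "x = coord x 0 *\<^sub>C Abs_ell2 u"
      by (intro ell2_eqI) (unfold scaleC.rep_eq u)
    then show "x \<in> range (\<lambda>a. a *\<^sub>C Abs_ell2 u)" by blast
  qed (auto simp: kernel_adj_perturbed_shift[OF assms(1)] coord_simps u u_def)
  ultimately show ?thesis by (metis ell2.span_singleton)
qed

text \<open>Along a solution the modulus does not decrease from \<open>N\<close> on, so the tail
  vanishes, and zeros propagate back to the start.\<close>

lemma kernel_adj_perturbed_shift_trivial:
  assumes "bounded (range \<epsilon>)" and "\<And>n. n \<ge> N \<Longrightarrow> 1 \<le> cmod (\<epsilon> n)" and "\<And>n. \<epsilon> n \<noteq> 0"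
  shows "kernel (adj (perturbed_shift \<epsilon>)) = {0}"
proof (intro equalityI subsetI)
  fix x assume "x \<in> kernel (adj (perturbed_shift \<epsilon>))"
  then have x: "coord x (Suc n) = - cnj (\<epsilon> n) * coord x n" for n
    by (simp add: kernel_adj_perturbed_shift[OF assms(1)])
  have "coord x n = 0" if "n \<ge> N" for n
  proof (rule coord_eq_0_of_nondecreasing[OF _ that])
    show "cmod (coord x n) \<le> cmod (coord x (Suc n))" if "n \<ge> N" for n
      using mult_right_mono[OF assms(2)[OF that], of "cmod (coord x n)"] by (simp add: x norm_mult)
  qed
  \<comment> \<open>Downward induction from \<open>N\<close>: the factor
    \<open>cnj (\<epsilon> n)\<close> is nonzero and can be cancelled.\<close>
  moreover have "coord x n = 0" if "n \<le> N" for n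
    using that by (induction n rule: inc_induct) (use x assms(3) calculation in auto)
  ultimately have "coord x n = 0" for n by (meson linear)
  then show "x \<in> {0}" by (auto simp: zero_ell2.rep_eq intro: ell2_eqI)
qed (simp add: kernel_adj_perturbed_shift[OF assms(1)] zero_ell2.rep_eq)

text \<open>Two independent reasons. Without zeros of \<epsilon>, coordinate 0 vanishes and the
  recurrence can be divided through upwards. With |\<epsilon>| \<le> 1 eventually, the tail vanishes
  by monotonicity and the recurrence carries this downwards by multiplication alone, whatever zeros
  \<epsilon> has.\<close>

lemma kernel_perturbed_shift_trivial:
  assumes "bounded (range \<epsilon>)" and "(\<forall>n\<ge>N. cmod (\<epsilon> n) \<le> 1) \<or> (\<forall>n. \<epsilon> n \<noteq> 0)"
  shows "kernel (perturbed_shift \<epsilon>) = {0}"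
proof (intro equalityI subsetI)
  fix x assume "x \<in> kernel (perturbed_shift \<epsilon>)"
  then have x0: "\<epsilon> 0 * coord x 0 = 0" and x: "coord x n = - \<epsilon> (Suc n) * coord x (Suc n)" for n
    unfolding kernel_perturbed_shift[OF assms(1)] by blast+
  have "coord x n = 0" for n
    using assms(2)
  proof
    assume "\<forall>n. \<epsilon> n \<noteq> 0"
    then show ?thesis
      by (induction n) (metis x0 x mult_eq_0_iff neg_equal_0_iff_equal)+
  next
    assume \<epsilon>: "\<forall>n\<ge>N. cmod (\<epsilon> n) \<le> 1"
    have tail: "coord x n = 0" if "n \<ge> N" for n
    proof (rule coord_eq_0_of_nondecreasing[OF _ that])
      fix n assume "n \<ge> N"
      then show "cmod (coord x n) \<le> cmod (coord x (Suc n))"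
        using \<epsilon> mult_right_mono[of "cmod (\<epsilon> (Suc n))" 1 "cmod (coord x (Suc n))"]
        by (simp add: x[of n] norm_mult)
    qed
    have "coord x n = 0" if "n \<le> N" for n
      using that
    proof (induction n rule: inc_induct)
      case (step n)
      then show ?case using x[of n] by simp
    qed (simp add: tail)
    with tail show ?thesis by (meson linear)
  qed
  then show "x \<in> {0}" by (auto simp: zero_ell2.rep_eq intro: ell2_eqI)
qed (simp add: kernel_perturbed_shift[OF assms(1)] zero_ell2.rep_eq)

text \<open>A kernel vector vanishes before the last zero of \<open>\<epsilon>\<close> and is determined after it by its
  value there.\<close>

lemma kernel_perturbed_shift_span:
  assumes "bounded (range \<epsilon>)" and "1 < r" and "\<And>n. n \<ge> N \<Longrightarrow> r \<le> cmod (\<epsilon> n)" and "\<epsilon> k = 0"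
  shows "\<exists>u. u \<noteq> 0 \<and> kernel (perturbed_shift \<epsilon>) = ell2.span {u}"
proof -
  \<comment> \<open>The last zero of \<epsilon>; it exists because |\<epsilon>| \<ge> r > 1 from
    \<open>N\<close> on leaves only finitely many zeros.\<close>
  define m where "m = Max {n. \<epsilon> n = 0}"
  have "n < N" if "\<epsilon> n = 0" for n
    using that assms(2) assms(3)[of n] by (cases "n < N") auto
  then have fin: "finite {n. \<epsilon> n = 0}" by (auto intro: finite_subset[of _ "{..<N}"])
  have m: "\<epsilon> m = 0" using Max_in[OF fin] assms(4) by (auto simp: m_def)
  have nz: "\<epsilon> n \<noteq> 0" if "n > m" for n using Max_ge[OF fin, of n] that by (auto simp: m_def)
  \<comment> \<open>Beyond \<open>m\<close> the recurrence can be inverted; the empty product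
    normalises the value at \<open>m\<close> to 1.\<close>
  define u where "u n = (if n < m then 0 else \<Prod>j\<in>{m<..n}. - inverse (\<epsilon> j))" for n
  have u_Suc: "u (Suc n) = - inverse (\<epsilon> (Suc n)) * u n" if "n \<ge> m" for n
  proof -
    have "{m<..Suc n} = insert (Suc n) {m<..n}" using that by auto
    then show ?thesis using that by (simp add: u_def)
  qed
  have "summable (\<lambda>n. (cmod (u n))\<^sup>2)"
  proof (rule summable_square_ratio)
    show "inverse r < 1" "0 \<le> inverse r" using assms(2) by (auto simp: inverse_less_1_iff)
    fix n assume "n \<ge> max N m"
    then show "cmod (u (Suc n)) \<le> inverse r * cmod (u n)"
      using assms(2) assms(3)[of "Suc n"]
      by (auto simp: u_Suc norm_mult norm_inverse intro!: mult_right_mono le_imp_inverse_le)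
  qed
  then have u: "coord (Abs_ell2 u) = u" by (simp add: Abs_ell2_inverse)
  have um: "u m = 1" by (simp add: u_def)
  have "Abs_ell2 u \<noteq> 0"
    using um u by (auto simp: zero_ell2.rep_eq)
  moreover have "kernel (perturbed_shift \<epsilon>) = range (\<lambda>a. a *\<^sub>C Abs_ell2 u)"
  proof (intro equalityI subsetI)
    fix x assume "x \<in> kernel (perturbed_shift \<epsilon>)"
    then have x: "coord x n = - \<epsilon> (Suc n) * coord x (Suc n)" for n
      unfolding kernel_perturbed_shift[OF assms(1)] by blast
    have below: "coord x n = 0" if "n < m" for n
    proof -
      have "n \<le> m - 1" using that by simp
      then show ?thesis
      proof (induction n rule: inc_induct)
        case base
        then show ?case using x[of "m - 1"] m that by simp
      next
        case (step n)
        then show ?case using x[of n] by simp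
      qed
    qed
    have "coord x n = coord x m * u n" for n
    proof (cases "n < m")
      case False
      then have "m \<le> n" by simp
      then show ?thesis
      proof (induction n rule: dec_induct)
        case (step n)
        then show ?case using x[of n] nz[of "Suc n"]
          by (simp add: u_Suc field_simps) (metis minus_minus)
      qed (simp add: um)
    qed (simp add: below u_def)
    then have "x = coord x m *\<^sub>C Abs_ell2 u"
      by (intro ell2_eqI) (unfold scaleC.rep_eq u)
    then show "x \<in> range (\<lambda>a. a *\<^sub>C Abs_ell2 u)" by blast
  next
    fix x assume "x \<in> range (\<lambda>a. a *\<^sub>C Abs_ell2 u)"
    then obtain a where a: "x = a *\<^sub>C Abs_ell2 u" by blast
    have u_0: "\<epsilon> 0 * u 0 = 0" using m by (cases "m = 0") (auto simp: u_def)
    have u_rec: "u n = - \<epsilon> (Suc n) * u (Suc n)" for n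
    proof (cases "n < m")
      case True
      \<comment> \<open>The critical index is n = m - 1: there \<open>u (Suc n)\<close> is 1, and
        the product vanishes only because \<epsilon> is 0 at \<open>m\<close>.\<close>
      then have "u n = 0" "\<epsilon> (Suc n) * u (Suc n) = 0"
        using m by (cases "Suc n = m"; simp add: u_def)+
      then show ?thesis by simp
    qed (use nz[of "Suc n"] in \<open>simp add: u_Suc\<close>)
    have x: "coord x n = a * u n" for n by (simp add: a coord_simps u)
    have "\<epsilon> 0 * coord x 0 = 0" using u_0 by (auto simp: x)
    moreover have "coord x n = - \<epsilon> (Suc n) * coord x (Suc n)" for n
      unfolding x by (subst u_rec) (rule mult.left_commute)
    ultimately show "x \<in> kernel (perturbed_shift \<epsilon>)"
      unfolding kernel_perturbed_shift[OF assms(1)] by blast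
  qed
  ultimately show ?thesis by (metis ell2.span_singleton)
qed

lemma finite_cdim_trivial: "finite_cdim {0}"
  by (auto simp: finite_cdim_def intro!: exI[of _ "{}"])

lemma finite_cdim_span_singleton: "finite_cdim (ell2.span {u})"
  by (auto simp: finite_cdim_def intro!: exI[of _ "{u}"])

lemma dim_trivial: "ell2.dim {0} = 0"
  using ell2.dim_span[of "{}"] ell2.dim_eq_card_independent[OF ell2.independent_empty] by simp

lemma dim_span_singleton: "u \<noteq> 0 \<Longrightarrow> ell2.dim (ell2.span {u}) = 1"
  by (simp add: ell2.dim_eq_card_independent)

lemma kernels_perturbed_shift:
  assumes "bounded (range \<epsilon>)" and "\<epsilon> \<longlonglongrightarrow> c" and "cmod c \<noteq> 1"
  shows "finite_cdim (kernel (perturbed_shift \<epsilon>))"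
    and "finite_cdim (kernel (adj (perturbed_shift \<epsilon>)))"
    and "fredholm_index (perturbed_shift \<epsilon>) = - (if cmod c < 1 then 1 else 0)"
proof -
  have lim: "(\<lambda>n. cmod (\<epsilon> n)) \<longlonglongrightarrow> cmod c" by (intro tendsto_norm assms)
  have "finite_cdim (kernel (perturbed_shift \<epsilon>)) \<and> finite_cdim (kernel (adj (perturbed_shift \<epsilon>)))
    \<and> fredholm_index (perturbed_shift \<epsilon>) = - (if cmod c < 1 then 1 else 0)"
  proof (cases "cmod c < 1")
    case True
    then obtain r where r: "cmod c < r" "r < 1" using dense by blast
    obtain N where N: "\<And>n. n \<ge> N \<Longrightarrow> cmod (\<epsilon> n) < r"
      using order_tendstoD(2)[OF lim r(1)] by (auto simp: eventually_sequentially)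
    have "kernel (perturbed_shift \<epsilon>) = {0}"
      using N r by (intro kernel_perturbed_shift_trivial[where N = N] assms) force
    moreover obtain u where "u \<noteq> 0" "kernel (adj (perturbed_shift \<epsilon>)) = ell2.span {u}"
      using kernel_adj_perturbed_shift_span[OF assms(1) r(2), of N] N r
      by (metis less_imp_le norm_ge_zero order_trans)
    ultimately show ?thesis
      using True by (simp add: fredholm_index_def finite_cdim_trivial finite_cdim_span_singleton
          dim_trivial dim_span_singleton del: ell2.dim_span)
  next
    case False
    then obtain r where r: "1 < r" "r < cmod c" using dense[of 1 "cmod c"] assms(3) by auto
    obtain N where N: "\<And>n. n \<ge> N \<Longrightarrow> r < cmod (\<epsilon> n)"
      using order_tendstoD(1)[OF lim r(2)] by (auto simp: eventually_sequentially)
    show ?thesis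
    proof (cases "\<exists>k. \<epsilon> k = 0")
      case True
      then obtain k where k: "\<epsilon> k = 0" by blast
      obtain u where "u \<noteq> 0" "kernel (perturbed_shift \<epsilon>) = ell2.span {u}"
        using kernel_perturbed_shift_span[OF assms(1) r(1), of N k] N k by (metis less_imp_le)
      \<comment> \<open>Applied with r = 0 and N = k: every index from k on has a zero of \<epsilon>
        at or before it.\<close>
      moreover obtain v where "v \<noteq> 0" "kernel (adj (perturbed_shift \<epsilon>)) = ell2.span {v}"
        using kernel_adj_perturbed_shift_span[OF assms(1), of 0 k] k by auto
      ultimately show ?thesis
        using \<open>\<not> cmod c < 1\<close> by (simp add: fredholm_index_def finite_cdim_span_singleton
            dim_span_singleton del: ell2.dim_span)
    next
      case False
      then have "kernel (perturbed_shift \<epsilon>) = {0}"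
        by (intro kernel_perturbed_shift_trivial assms) simp
      moreover have "kernel (adj (perturbed_shift \<epsilon>)) = {0}"
        using N r False by (intro kernel_adj_perturbed_shift_trivial[where N = N] assms) force+
      ultimately show ?thesis
        using \<open>\<not> cmod c < 1\<close> by (simp add: fredholm_index_def finite_cdim_trivial)
    qed
  qed
  then show "finite_cdim (kernel (perturbed_shift \<epsilon>))"
    and "finite_cdim (kernel (adj (perturbed_shift \<epsilon>)))"
    and "fredholm_index (perturbed_shift \<epsilon>) = - (if cmod c < 1 then 1 else 0)"
    by blast+
qed

section \<open>Closed range\<close>

text \<open>If x lies outside S, its positive distance to S controls the coefficient of x, so
  convergence of the sum forces convergence of both summands.\<close>

lemma closed_subspace_add_line:
  assumes "closed S" "ell2.subspace S"
  shows "closed {s + a *\<^sub>C x | s a. s \<in> S}"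
proof (cases "x \<in> S")
  case True
  have "{s + a *\<^sub>C x | s a. s \<in> S} = S"
  proof (intro equalityI subsetI)
    fix y assume "y \<in> S"
    then have "y = y + 0 *\<^sub>C x \<and> y \<in> S" by simp
    then show "y \<in> {s + a *\<^sub>C x | s a. s \<in> S}" by blast
  qed (use assms(2) True in \<open>auto intro: ell2.subspace_add ell2.subspace_scale\<close>)
  then show ?thesis using assms(1) by simp
next
  case False
  then obtain d where "0 < d" "ball x d \<subseteq> - S"
    using assms(1) openE[of "- S" x] by (auto simp: open_Compl)
  then have d: "0 < d" "\<And>s. s \<in> S \<Longrightarrow> d \<le> dist x s" by (force simp: not_less[symmetric])+
  \<comment> \<open>For a \<noteq> 0, divide by a and compare x with the point - s / a of the
    subspace.\<close>
  have coeff: "cmod a * d \<le> norm (s + a *\<^sub>C x)" if "s \<in> S" for s a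
  proof (cases "a = 0")
    case False
    have "- inverse a *\<^sub>C s \<in> S" using that assms(2) by (intro ell2.subspace_scale)
    from d(2)[OF this] have "cmod a * d \<le> cmod a * norm (x - - inverse a *\<^sub>C s)"
      by (intro mult_left_mono) (auto simp: dist_norm)
    also have "\<dots> = norm (a *\<^sub>C (x - - inverse a *\<^sub>C s))" by (simp add: norm_scaleC)
    also have "a *\<^sub>C (x - - inverse a *\<^sub>C s) = s + a *\<^sub>C x"
      using False by (intro ell2_eqI) (simp add: coord_simps field_simps)
    finally show ?thesis .
  qed simp
  show ?thesis
    unfolding closed_sequential_limits
  proof (intro allI impI, elim conjE)
    fix y l assume y: "\<forall>n::nat. y n \<in> {s + a *\<^sub>C x | s a. s \<in> S}" and l: "y \<longlonglongrightarrow> l"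
    then have "\<forall>n. \<exists>s a. s \<in> S \<and> y n = s + a *\<^sub>C x" by blast
    then obtain s a where sa: "\<And>n. s n \<in> S" "\<And>n. y n = s n + a n *\<^sub>C x" by metis
    have diff: "cmod (a m - a n) * d \<le> norm (y m - y n)" for m n
    proof -
      have "y m - y n = (s m - s n) + (a m - a n) *\<^sub>C x"
        by (simp add: sa ell2.scale_left_diff_distrib)
      then show ?thesis using coeff[OF ell2.subspace_diff[OF assms(2) sa(1) sa(1)]] by simp
    qed
    have "Cauchy a"
    proof (rule CauchyI)
      fix e :: real assume "0 < e"
      then have "0 < e * d" using d(1) by simp
      then obtain N where "\<And>m n. m \<ge> N \<Longrightarrow> n \<ge> N \<Longrightarrow> norm (y m - y n) < e * d"
        using LIMSEQ_imp_Cauchy[OF l] by (metis CauchyD)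
      then show "\<exists>N. \<forall>m\<ge>N. \<forall>n\<ge>N. norm (a m - a n) < e"
        using diff d(1) by (metis le_less_trans mult_less_cancel_right_pos)
    qed
    then obtain b where b: "a \<longlonglongrightarrow> b" by (auto simp: Cauchy_convergent_iff convergent_def)
    have "(\<lambda>n. y n - a n *\<^sub>C x) \<longlonglongrightarrow> l - b *\<^sub>C x"
      by (intro tendsto_diff l bounded_linear.tendsto[OF bounded_linear_scaleC_left] b)
    then have "s \<longlonglongrightarrow> l - b *\<^sub>C x" by (simp add: sa)
    then have "l - b *\<^sub>C x \<in> S" using closed_sequentially[OF assms(1)] sa(1) by blast
    moreover have "l = (l - b *\<^sub>C x) + b *\<^sub>C x" by simp
    ultimately show "l \<in> {s + a *\<^sub>C x | s a. s \<in> S}" by blast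
  qed
qed

text \<open>A lower bound makes the image of a complete subspace complete. Requiring it only where
  the first \<open>N\<close> coordinates vanish costs \<open>N\<close> extra lines in the range,
  each of which preserves closedness.\<close>

lemma closed_range_if_bounded_below:
  assumes A: "bounded_clinear A" and "0 < e"
    and below: "\<And>x. (\<forall>i<N. coord x i = 0) \<Longrightarrow> e * norm x \<le> norm (A x)"
  shows "closed (range A)"
proof -
  define M where "M n = {x. \<forall>i<n. coord x i = 0}" for n
  have lin: "bounded_linear A" "\<And>a x. A (a *\<^sub>C x) = a *\<^sub>C A x"
    using A by (auto simp: bounded_clinear_def)
  have sub: "ell2.subspace (A ` M n)" for n
  proof (rule ell2.subspaceI)
    have "0 \<in> M n" by (simp add: M_def zero_ell2.rep_eq)
    then show "0 \<in> A ` M n" using linear_0[OF bounded_linear.linear[OF lin(1)]] by force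
    fix x y assume "x \<in> A ` M n" "y \<in> A ` M n"
    then obtain x' y' where "x = A x'" "y = A y'" "x' + y' \<in> M n"
      by (auto simp: M_def coord_simps)
    then show "x + y \<in> A ` M n"
      using linear_add[OF bounded_linear.linear[OF lin(1)]] by (metis imageI)
  next
    fix a x assume "x \<in> A ` M n"
    then show "a *\<^sub>C x \<in> A ` M n"
      by (auto simp: M_def coord_simps simp flip: lin(2) intro!: imageI)
  qed
  have step_eq: "A ` M n = {s + a *\<^sub>C A (basis_vec n) | s a. s \<in> A ` M (Suc n)}" for n
  proof (intro equalityI subsetI)
    fix y assume "y \<in> A ` M n"
    then obtain x where x: "y = A x" "x \<in> M n" by blast
    have "x - coord x n *\<^sub>C basis_vec n \<in> M (Suc n)"
      using x by (auto simp: M_def coord_simps less_Suc_eq)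
    moreover have "y = A (x - coord x n *\<^sub>C basis_vec n) + coord x n *\<^sub>C A (basis_vec n)"
      by (simp add: x lin(2)[symmetric] linear_diff[OF bounded_linear.linear[OF lin(1)]])
    ultimately show "y \<in> {s + a *\<^sub>C A (basis_vec n) | s a. s \<in> A ` M (Suc n)}" by blast
  next
    fix y assume "y \<in> {s + a *\<^sub>C A (basis_vec n) | s a. s \<in> A ` M (Suc n)}"
    then obtain x a where x: "x \<in> M (Suc n)" "y = A x + a *\<^sub>C A (basis_vec n)" by blast
    then have "y = A (x + a *\<^sub>C basis_vec n)"
      by (simp add: lin(2)[symmetric] linear_add[OF bounded_linear.linear[OF lin(1)]])
    moreover have "x + a *\<^sub>C basis_vec n \<in> M n" using x by (auto simp: M_def coord_simps)
    ultimately show "y \<in> A ` M n" by blast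
  qed
  \<comment> \<open>Descends from \<open>N\<close>, where the lower bound applies, to 0, where
    \<open>M 0\<close> is the whole space.\<close>
  have "closed (A ` M n)" if "n \<le> N" for n
    using that
  proof (induction n rule: inc_induct)
    case base
    have "subspace (M N)"
      by (auto simp: subspace_def M_def coord_simps)
    moreover have "closed (M N)"
      unfolding closed_sequential_limits
    proof (intro allI impI, elim conjE)
      fix x l assume x: "\<forall>n::nat. x n \<in> M N" and "x \<longlonglongrightarrow> l"
      then have "(\<lambda>n. coord (x n) i) \<longlonglongrightarrow> coord l i" for i by (intro tendsto_coord)
      moreover have "(\<lambda>n. coord (x n) i) = (\<lambda>n. 0)" if "i < N" for i
        using x that by (auto simp: M_def)
      ultimately show "l \<in> M N" by (force simp: M_def dest: LIMSEQ_unique intro: tendsto_const)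
    qed
    ultimately have "complete (A ` M N)"
      using below
      by (intro complete_isometric_image[OF assms(2) _ lin(1)]) (auto simp: complete_eq_closed M_def)
    then show ?case by (rule complete_imp_closed)
  next
    case (step n)
    then show ?case unfolding step_eq[of n] by (intro closed_subspace_add_line sub)
  qed
  from this[of 0] show ?thesis by (simp add: M_def)
qed

lemma fredholm_perturbed_shift:
  assumes "bounded (range \<epsilon>)" and "\<epsilon> \<longlonglongrightarrow> c" and "cmod c \<noteq> 1"
  shows "fredholm (perturbed_shift \<epsilon>)"
proof -
  have lim: "(\<lambda>n. cmod (\<epsilon> n)) \<longlonglongrightarrow> cmod c" by (intro tendsto_norm assms)
  have "\<exists>e N. 0 < e \<and> (\<forall>x. (\<forall>i<N. coord x i = 0) \<longrightarrow> e * norm x \<le> norm (perturbed_shift \<epsilon> x))"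
  proof (cases "cmod c < 1")
    case True
    then obtain r where r: "cmod c < r" "r < 1" using dense by blast
    obtain N where N: "\<And>n. n \<ge> N \<Longrightarrow> cmod (\<epsilon> n) < r"
      using order_tendstoD(2)[OF lim r(1)] by (auto simp: eventually_sequentially)
    have "0 \<le> r" using r(1) norm_ge_zero[of c] by linarith
    \<comment> \<open>The shift is isometric and the diagonal part has norm at most r on these
      vectors; the reverse triangle inequality leaves 1 - r.\<close>
    have "(1 - r) * norm x \<le> norm (perturbed_shift \<epsilon> x)" if x: "\<forall>i<N. coord x i = 0" for x
    proof -
      have "norm (diag_operator \<epsilon> x) \<le> r * norm x"
      proof (rule norm_ell2_mono[OF _ \<open>0 \<le> r\<close>])
        fix n
        show "cmod (coord (diag_operator \<epsilon> x) n) \<le> r * cmod (coord x n)"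
          using x N[of n] by (cases "n < N")
            (auto simp: coord_diag_operator assms norm_mult intro!: mult_right_mono)
      qed
      then show ?thesis
        using norm_diff_ineq[of "shift x" "diag_operator \<epsilon> x"]
        by (simp add: perturbed_shift_def norm_shift algebra_simps)
    qed
    then show ?thesis using r(2) by (intro exI[of _ "1 - r"] exI[of _ N]) auto
  next
    case False
    then obtain r where r: "1 < r" "r < cmod c" using dense[of 1 "cmod c"] assms(3) by auto
    obtain N where N: "\<And>n. n \<ge> N \<Longrightarrow> r < cmod (\<epsilon> n)"
      using order_tendstoD(1)[OF lim r(2)] by (auto simp: eventually_sequentially)
    \<comment> \<open>The roles are exchanged: the diagonal part stretches by at least r and the
      shift subtracts exactly the norm of x.\<close>
    have "(r - 1) * norm x \<le> norm (perturbed_shift \<epsilon> x)" if x: "\<forall>i<N. coord x i = 0" for x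
    proof -
      have "norm x \<le> inverse r * norm (diag_operator \<epsilon> x)"
      proof (rule norm_ell2_mono)
        fix n
        show "cmod (coord x n) \<le> inverse r * cmod (coord (diag_operator \<epsilon> x) n)"
          using x N[of n] r(1) by (cases "n < N")
            (auto simp: coord_diag_operator assms norm_mult field_simps intro!: mult_right_mono)
      qed (use r in simp)
      then have "r * norm x \<le> norm (diag_operator \<epsilon> x)" using r(1) by (simp add: field_simps)
      then show ?thesis
        using norm_diff_ineq[of "diag_operator \<epsilon> x" "shift x"]
        by (simp add: perturbed_shift_def norm_shift algebra_simps)
    qed
    then show ?thesis using r(1) by (intro exI[of _ "r - 1"] exI[of _ N]) auto
  qed
  then have "closed (range (perturbed_shift \<epsilon>))"
    using closed_range_if_bounded_below[OF bounded_clinear_perturbed_shift[OF assms(1)]] by blast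
  then show ?thesis
    by (simp add: fredholm_def bounded_clinear_perturbed_shift kernels_perturbed_shift[OF assms] assms)
qed

section \<open>Compactness of the perturbation\<close>

text \<open>Each further coordinate contributes a compact disc, and the box is a continuous image of
  a product. It replaces a finite-rank range in the compactness proof below.\<close>

lemma compact_finite_box: "compact {x. \<forall>n. cmod (coord x n) \<le> (if n < N then r else 0)}"
proof (induction N)
  case 0
  have "{x. \<forall>n. cmod (coord x n) \<le> (if n < 0 then r else 0)} = {0}"
    by (auto simp: zero_ell2.rep_eq intro: ell2_eqI)
  then show ?case by simp
next
  case (Suc N)
  let ?B = "\<lambda>N. {x. \<forall>n. cmod (coord x n) \<le> (if n < N then r else 0)}"
  have "?B (Suc N) = (\<lambda>(a, x). a *\<^sub>C basis_vec N + x) ` (cball 0 r \<times> ?B N)"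
  proof (intro equalityI subsetI)
    fix x assume x: "x \<in> ?B (Suc N)"
    have "x - coord x N *\<^sub>C basis_vec N \<in> ?B N"
    proof (intro CollectI allI)
      fix n
      show "cmod (coord (x - coord x N *\<^sub>C basis_vec N) n) \<le> (if n < N then r else 0)"
        using x[THEN CollectD, rule_format, of n] by (auto simp: coord_simps)
    qed
    moreover have "coord x N \<in> cball 0 r" using x[THEN CollectD, rule_format, of N] by simp
    moreover have "x = coord x N *\<^sub>C basis_vec N + (x - coord x N *\<^sub>C basis_vec N)" by simp
    ultimately show "x \<in> (\<lambda>(a, x). a *\<^sub>C basis_vec N + x) ` (cball 0 r \<times> ?B N)"
      by (metis (no_types, lifting) SigmaI case_prod_conv image_eqI)
  next
    fix y assume "y \<in> (\<lambda>(a, x). a *\<^sub>C basis_vec N + x) ` (cball 0 r \<times> ?B N)"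
    then obtain a x where ax: "y = a *\<^sub>C basis_vec N + x" "cmod a \<le> r" "x \<in> ?B N" by auto
    show "y \<in> ?B (Suc N)"
    proof (intro CollectI allI)
      fix n
      show "cmod (coord y n) \<le> (if n < Suc N then r else 0)"
        using ax(2) ax(3)[THEN CollectD, rule_format, of n]
        by (auto simp: ax(1) coord_simps split: if_splits)
    qed
  qed
  moreover have "compact ((\<lambda>(a, x). a *\<^sub>C basis_vec N + x) ` (cball 0 r \<times> ?B N))"
    unfolding split_beta
    by (intro compact_continuous_image compact_Times compact_cball Suc.IH continuous_intros
        bounded_linear.continuous_on[OF bounded_linear_scaleC_left])
  ultimately show ?case by simp
qed

text \<open>Cutting \<delta> off at \<open>N\<close> sends the unit ball into a compact box, while
  the discarded part has norm at most e / 3; hence the image is totally bounded.\<close>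

lemma compact_diag_operator:
  assumes "\<delta> \<longlonglongrightarrow> 0"
  shows "compact_operator (diag_operator \<delta>)"
proof -
  have b: "bounded (range \<delta>)" using assms convergent_imp_bounded by blast
  then obtain r where r: "\<And>n. cmod (\<delta> n) \<le> r" by (auto simp: bounded_iff)
  have "\<exists>k. finite k \<and> closure (diag_operator \<delta> ` cball 0 1) \<subseteq> (\<Union>x\<in>k. ball x e)" if "0 < e" for e
  proof -
    obtain N where N: "\<And>n. n \<ge> N \<Longrightarrow> cmod (\<delta> n) < e / 3"
      using LIMSEQ_D[OF assms, of "e / 3"] \<open>0 < e\<close> by auto
    have "0 < e / 3" using \<open>0 < e\<close> by simp
    then obtain k where k: "finite k"
      "{x. \<forall>n. cmod (coord x n) \<le> (if n < N then r else 0)} \<subseteq> (\<Union>x\<in>k. ball x (e / 3))"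
      using compact_finite_box[of N r] unfolding compact_eq_totally_bounded by blast
    \<comment> \<open>One e / 3 is for the net of the box, one for the cut-off. Closed balls of
      radius 2e / 3 let the inclusion pass to the closure and still fit inside open balls of radius
      e.\<close>
    have "diag_operator \<delta> ` cball 0 1 \<subseteq> (\<Union>x\<in>k. cball x (2 * e / 3))"
    proof
      fix y assume "y \<in> diag_operator \<delta> ` cball 0 1"
      then obtain x where x: "y = diag_operator \<delta> x" "norm x \<le> 1" by auto
      define p where "p = diag_operator (\<lambda>n. if n < N then \<delta> n else 0) x"
      have "bounded (range (\<lambda>n. if n < N then \<delta> n else 0))"
        using r norm_ge_zero order_trans[OF norm_ge_zero r]
        by (intro boundedI[of _ r]) (auto split: if_splits)
      then have p: "coord p n = (if n < N then \<delta> n * coord x n else 0)" for n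
        by (simp add: p_def coord_diag_operator)
      have "cmod (coord p n) \<le> (if n < N then r else 0)" for n
        using mult_mono[OF r[of n] order_trans[OF cmod_coord_le_norm x(2)]]
          order_trans[OF norm_ge_zero r]
        by (auto simp: p norm_mult)
      then obtain z where z: "z \<in> k" "dist z p < e / 3" using k(2) by force
      have "norm (y - p) \<le> e / 3 * norm x"
      proof (rule norm_ell2_mono)
        fix n
        show "cmod (coord (y - p) n) \<le> e / 3 * cmod (coord x n)"
          using mult_right_mono[OF less_imp_le[OF N[of n]], of "cmod (coord x n)"] \<open>0 < e\<close>
          by (auto simp: coord_minus p x(1) coord_diag_operator[OF b] norm_mult)
      qed (use \<open>0 < e\<close> in simp)
      also have "\<dots> \<le> e / 3" using x(2) \<open>0 < e\<close> by (simp add: mult_left_le)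
      finally have "dist z y \<le> 2 * e / 3"
        using z(2) dist_triangle[of z y p] by (simp add: dist_norm norm_minus_commute)
      then show "y \<in> (\<Union>x\<in>k. cball x (2 * e / 3))" using z(1) by auto
    qed
    then have "closure (diag_operator \<delta> ` cball 0 1) \<subseteq> (\<Union>x\<in>k. cball x (2 * e / 3))"
      using k(1) by (intro closure_minimal closed_UN) auto
    also have "\<dots> \<subseteq> (\<Union>x\<in>k. ball x e)" using \<open>0 < e\<close> by (intro UN_mono) auto
    finally show ?thesis using k(1) by blast
  qed
  then have "compact (closure (diag_operator \<delta> ` cball 0 1))"
    by (simp add: compact_eq_totally_bounded complete_eq_closed)
  then show ?thesis by (simp add: compact_operator_def bounded_clinear_diag_operator[OF b])
qed

section \<open>Toeplitz operators\<close>

lemma toeplitz_eqI: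
  assumes "bounded_clinear A"
    and "\<And>m n. coord (A (basis_vec n)) m = fourier_coeff h (int m - int n)"
  shows "toeplitz h = A"
  unfolding toeplitz_def
proof (rule the_equality)
  fix B assume B: "bounded_clinear B \<and>
    (\<forall>m n. cinner (basis_vec m) (B (basis_vec n)) = fourier_coeff h (int m - int n))"
  then show "B = A"
    using assms by (intro bounded_clinear_eqI) (auto simp: cinner_basis_vec_left intro!: ell2_eqI)
qed (use assms in \<open>simp add: cinner_basis_vec_left\<close>)

lemma integral_cis_period:
  "((\<lambda>t. cis (of_int k * t)) has_integral (if k = 0 then of_real (2 * pi) else 0)) {0..2 * pi}"
proof (cases "k = 0")
  case True
  then show ?thesis using has_integral_const_real[of "1 :: complex" 0 "2 * pi"]
    by (simp add: scaleR_conv_of_real)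
next
  case False
  define F where "F t = exp (\<i> * of_int k * t) / (\<i> * of_int k)" for t :: complex
  have "(F has_field_derivative exp (\<i> * of_int k * t)) (at t)" for t
    unfolding F_def using False by (auto intro!: derivative_eq_intros)
  then have "((\<lambda>t. F (of_real t)) has_vector_derivative cis (of_int k * t)) (at t within {0..2 * pi})"
    for t :: real
    using has_vector_derivative_real_field[of F _ t] by (simp add: cis_conv_exp mult.assoc)
  then have "((\<lambda>t. cis (of_int k * t)) has_integral F (of_real (2 * pi)) - F (of_real 0)) {0..2 * pi}"
    by (intro fundamental_theorem_of_calculus) auto
  moreover have "F (of_real (2 * pi)) = F (of_real 0)"
    using exp_integer_2pi[of "of_int k"] by (simp add: F_def ac_simps)
  ultimately show ?thesis using False by simp
qed

lemma fourier_coeff_eqI: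
  assumes "((\<lambda>t. h (cis t) * cis (- (of_int k * t))) has_integral of_real (2 * pi) * a) {0..2 * pi}"
  shows "fourier_coeff h k = a"
  using integral_unique[OF assms] by (simp add: fourier_coeff_def)

lemma fourier_coeff_shifted_id:
  "fourier_coeff (\<lambda>z. z + c) k = (if k = 1 then 1 else if k = 0 then c else 0)"
proof (rule fourier_coeff_eqI)
  have "((\<lambda>t. cis (of_int (1 - k) * t) + c * cis (of_int (- k) * t)) has_integral
      (if 1 - k = 0 then of_real (2 * pi) else 0) + c * (if - k = 0 then of_real (2 * pi) else 0))
      {0..2 * pi}"
    by (intro has_integral_add has_integral_mult_right integral_cis_period)
  then show "((\<lambda>t. (cis t + c) * cis (- (of_int k * t))) has_integral
      of_real (2 * pi) * (if k = 1 then 1 else if k = 0 then c else 0)) {0..2 * pi}"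
    by (rule has_integral_eq_rhs[OF has_integral_eq, rotated])
      (auto simp: cis_mult algebra_simps)
qed

lemma toeplitz_shifted_id: "toeplitz (\<lambda>z. z + c) = (\<lambda>x. shift x + c *\<^sub>C x)"
proof (rule toeplitz_eqI)
  show "bounded_clinear (\<lambda>x. shift x + c *\<^sub>C x)"
    by (intro bounded_clinear_add bounded_clinear_shift bounded_clinear_scaleC)
  show "coord (shift (basis_vec n) + c *\<^sub>C basis_vec n) m
      = fourier_coeff (\<lambda>z. z + c) (int m - int n)" for m n
    by (auto simp: shift_basis_vec coord_simps fourier_coeff_shifted_id)
qed

text \<open>For c \<noteq> 0 the solutions are multiples of \<open>(- 1 / c) ^ k\<close>, which blow
  up as k \<rightarrow> \<infinity> if |c| < 1 and as k \<rightarrow> -\<infinity> if |c| > 1.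
  Iterating in that direction bounds |d k| by a null sequence.\<close>

lemma bounded_geometric_recurrence_eq_0:
  fixes d :: "int \<Rightarrow> complex"
  assumes rec: "\<And>k. d (k - 1) + c * d k = 0" and b: "\<And>k. cmod (d k) \<le> B" and c: "cmod c \<noteq> 1"
  shows "d k = 0"
proof -
  have step: "cmod (d (k - 1)) = cmod c * cmod (d k)" for k
    using rec[of k] by (metis add_eq_0_iff norm_minus_cancel norm_mult)
  have iter: "cmod (d k) = cmod c ^ n * cmod (d (k + int n))" for k n
  proof (induction n)
    case (Suc n)
    then show ?case using step[of "k + int n + 1"] by (simp add: ac_simps)
  qed simp
  show ?thesis
  proof (cases "cmod c < 1")
    case True
    have "cmod (d k) \<le> 0"
    proof (rule LIMSEQ_le_const)
      show "(\<lambda>n. cmod c ^ n * B) \<longlonglongrightarrow> 0"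
        using True by (intro tendsto_mult_left_zero LIMSEQ_power_zero) simp
      have "cmod (d k) \<le> cmod c ^ n * B" for n
        by (subst iter[of k n]) (auto intro!: mult_left_mono b)
      then show "\<exists>N. \<forall>n\<ge>N. cmod (d k) \<le> cmod c ^ n * B" by blast
    qed
    then show ?thesis by simp
  next
    case False
    then have c1: "cmod c > 1" using c by simp
    have "cmod (d k) \<le> 0"
    proof (rule LIMSEQ_le_const)
      show "(\<lambda>n. inverse (cmod c) ^ n * B) \<longlonglongrightarrow> 0"
        using c1 by (intro tendsto_mult_left_zero LIMSEQ_power_zero) (simp add: inverse_less_1_iff)
      have "cmod (d k) = inverse (cmod c) ^ n * cmod (d (k - int n))" for n
        using iter[of "k - int n" n] c1 by (auto simp: field_simps)
      then show "\<exists>N. \<forall>n\<ge>N. cmod (d k) \<le> inverse (cmod c) ^ n * B"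
        by (metis b mult_left_mono inverse_nonnegative_iff_nonnegative norm_ge_zero zero_le_power)
    qed
    then show ?thesis by simp
  qed
qed

text \<open>Instead of summing Laurent series, we use that the Fourier coefficients of \<open>1 / (z + c)\<close> are
  the only bounded sequence \<open>a\<close> with \<open>a (k - 1) + c * a k = of_bool (k = 0)\<close>.\<close>

lemma fourier_coeff_inverse_shifted_id:
  assumes c: "cmod c \<noteq> 1"
    and rec: "\<And>k. a (k - 1) + c * a k = of_bool (k = 0)" and b: "\<And>k. cmod (a k) \<le> B"
  shows "fourier_coeff (\<lambda>z. 1 / (z + c)) k = a k"
proof -
  define g where "g = (\<lambda>z. 1 / (z + c))"
  have nz: "cis t + c \<noteq> 0" for t
    using c by (metis add_eq_0_iff norm_cis norm_minus_cancel)
  have int: "(\<lambda>t. g (cis t) * cis (- (of_int k * t))) integrable_on {0..2 * pi}" for k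
    unfolding g_def cis_conv_exp
    by (intro integrable_continuous_interval continuous_intros) (metis nz cis_conv_exp)
  \<comment> \<open>The Fourier coefficients of the identity \<open>(z + c) * g z = 1\<close>:
    multiplication by z shifts the index by one.\<close>
  have rec': "fourier_coeff g (k - 1) + c * fourier_coeff g k = of_bool (k = 0)" for k
  proof -
    have sum: "((\<lambda>t. g (cis t) * cis (- (of_int (k - 1) * t)) + c * (g (cis t) * cis (- (of_int k * t))))
      has_integral (of_real (2 * pi) * (fourier_coeff g (k - 1) + c * fourier_coeff g k)))
      {0..2 * pi}"
      using has_integral_add[OF integrable_integral[OF int]
          has_integral_mult_right[OF integrable_integral[OF int]], of "k - 1" c k]
      by (simp add: fourier_coeff_def algebra_simps)
    have eq: "g (cis t) * cis (- (of_int (k - 1) * t)) + c * (g (cis t) * cis (- (of_int k * t)))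
      = cis (of_int (- k) * t)" for t
    proof -
      have "cis (- (of_int (k - 1) * t)) = cis t * cis (- (of_int k * t))"
        by (simp add: cis_mult algebra_simps)
      then have "g (cis t) * cis (- (of_int (k - 1) * t)) + c * (g (cis t) * cis (- (of_int k * t)))
        = (cis t + c) * g (cis t) * cis (- (of_int k * t))"
        by (simp add: algebra_simps)
      then show ?thesis using nz by (simp add: g_def)
    qed
    have "of_real (2 * pi) * (fourier_coeff g (k - 1) + c * fourier_coeff g k)
        = (if - k = 0 then of_real (2 * pi) else 0)"
      by (rule has_integral_unique[OF sum[unfolded eq] integral_cis_period])
    then show ?thesis by (auto split: if_splits)
  qed
  \<comment> \<open>|1 - |c|| is the distance from - c to the unit circle, so C bounds g
    there.\<close>
  define C where "C = 1 / \<bar>1 - cmod c\<bar>"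
  have b': "cmod (fourier_coeff g k) \<le> C" for k
  proof -
    have "\<bar>1 - cmod c\<bar> \<le> cmod (cis t + c)" for t
      using norm_triangle_ineq3[of "cis t" "- c"] by simp
    then have "cmod (g (cis t) * cis (- (of_int k * t))) \<le> C" for t
      using c nz by (auto simp: g_def C_def norm_mult norm_divide intro!: divide_left_mono mult_pos_pos)
    then have "cmod (integral {0..2 * pi} (\<lambda>t. g (cis t) * cis (- (of_int k * t))))
        \<le> C * (2 * pi)"
      using has_integral_bound_real[OF _ finite.emptyI integrable_integral[OF int[of k]], of C]
      by (simp add: C_def)
    then show ?thesis by (simp add: fourier_coeff_def norm_divide norm_mult field_simps)
  qed
  have "fourier_coeff g k - a k = 0"
  proof (rule bounded_geometric_recurrence_eq_0[OF _ _ c])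
    show "fourier_coeff g (k - 1) - a (k - 1) + c * (fourier_coeff g k - a k) = 0" for k
      using rec[of k] rec'[of k] by (simp add: algebra_simps)
    show "cmod (fourier_coeff g k - a k) \<le> C + B" for k
      using norm_triangle_ineq4[of "fourier_coeff g k" "a k"] b[of k] b'[of k] by linarith
  qed
  then show ?thesis by (simp add: g_def)
qed

text \<open>Contractions with absolutely summable coefficients converge in norm, and continuity of
  coordinates lets matrix entries be computed termwise.\<close>

lemma bounded_clinear_series:
  assumes W: "\<And>k. bounded_clinear (W k)" and contr: "\<And>k x. norm (W k x) \<le> norm x"
    and a: "summable (\<lambda>k. cmod (a k))"
  shows "bounded_clinear (\<lambda>x. \<Sum>k. a k *\<^sub>C W k x)"
    and "coord (\<Sum>k. a k *\<^sub>C W k x) n = (\<Sum>k. a k * coord (W k x) n)"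
proof -
  have le: "norm (a k *\<^sub>C W k x) \<le> cmod (a k) * norm x" for k x
    by (simp add: norm_scaleC mult_left_mono contr)
  have a': "summable (\<lambda>k. cmod (a k) * norm x)" for x using a by (rule summable_mult2)
  have sn: "summable (\<lambda>k. norm (a k *\<^sub>C W k x))" for x
    by (rule summable_comparison_test[OF _ a'[of x]]) (use le in auto)
  then have s: "summable (\<lambda>k. a k *\<^sub>C W k x)" for x by (rule summable_norm_cancel)
  have lin: "W k (x + y) = W k x + W k y" "W k (b *\<^sub>C x) = b *\<^sub>C W k x" for k x y b
    using W[of k] by (auto simp: bounded_clinear_def linear_add[OF bounded_linear.linear])
  show "bounded_clinear (\<lambda>x. \<Sum>k. a k *\<^sub>C W k x)"
  proof (rule bounded_clinearI)
    fix x y :: ell2 and b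
    show "(\<Sum>k. a k *\<^sub>C W k (x + y)) = (\<Sum>k. a k *\<^sub>C W k x) + (\<Sum>k. a k *\<^sub>C W k y)"
      by (simp add: lin ell2.scale_right_distrib suminf_add[OF s s])
    show "(\<Sum>k. a k *\<^sub>C W k (b *\<^sub>C x)) = b *\<^sub>C (\<Sum>k. a k *\<^sub>C W k x)"
      using bounded_linear.suminf[OF bounded_linear_scaleC s, of b x]
      by (simp add: lin mult.commute)
    have "norm (\<Sum>k. a k *\<^sub>C W k x) \<le> (\<Sum>k. norm (a k *\<^sub>C W k x))" by (rule summable_norm[OF sn])
    also have "\<dots> \<le> (\<Sum>k. cmod (a k) * norm x)" by (intro suminf_le le sn a')
    also have "\<dots> = (\<Sum>k. cmod (a k)) * norm x" by (rule suminf_mult2[OF a, symmetric])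
    finally show "norm (\<Sum>k. a k *\<^sub>C W k x) \<le> (\<Sum>k. cmod (a k)) * norm x" .
  qed
  show "coord (\<Sum>k. a k *\<^sub>C W k x) n = (\<Sum>k. a k * coord (W k x) n)"
    using bounded_linear.suminf[OF bounded_linear_coord[of n] s[of x]] by (simp add: coord_simps)
qed

lemma bounded_clinear_funpow:
  assumes "bounded_clinear A" "\<And>x. norm (A x) \<le> norm x"
  shows "bounded_clinear (A ^^ k)" and "norm ((A ^^ k) x) \<le> norm x"
proof -
  show "bounded_clinear (A ^^ k)"
  proof (induction k)
    case (Suc k)
    then show ?case using assms(1) bounded_linear_compose[of A "A ^^ k"]
      by (simp add: bounded_clinear_def o_def)
  qed (simp add: bounded_clinear_def id_def)
  show "norm ((A ^^ k) x) \<le> norm x"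
    by (induction k) (use assms(2) in \<open>auto intro: order_trans\<close>)
qed

lemma coord_funpow_backshift: "coord ((backshift ^^ k) x) n = coord x (n + k)"
  by (induction k arbitrary: n) (simp_all add: backshift.rep_eq)

lemma funpow_shift_basis_vec: "(shift ^^ k) (basis_vec n) = basis_vec (n + k)"
  by (induction k) (simp_all add: shift_basis_vec)

text \<open>\<open>toeplitz\<close> is meaningful only once a bounded operator with these entries
  exists. Replacing z by \<open>shift\<close>, or 1 / z by \<open>backshift\<close>, in the
  geometric expansion of 1 / (z + c) provides one.\<close>

lemma toeplitz_inverse_shifted_id:
  assumes c: "cmod c \<noteq> 1"
  shows "bounded_clinear (toeplitz (\<lambda>z. 1 / (z + c)))"
    and "coord (toeplitz (\<lambda>z. 1 / (z + c)) (basis_vec n)) m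
      = fourier_coeff (\<lambda>z. 1 / (z + c)) (int m - int n)"
    and "fourier_coeff (\<lambda>z. 1 / (z + c)) (- 1) = of_bool (cmod c < 1)"
proof -
  let ?g = "\<lambda>z. 1 / (z + c)"
  have "\<exists>A. bounded_clinear A \<and> (\<forall>m n. coord (A (basis_vec n)) m = fourier_coeff ?g (int m - int n))
      \<and> fourier_coeff ?g (- 1) = of_bool (cmod c < 1)"
  proof (cases "cmod c < 1")
    case True
    \<comment> \<open>On the circle, 1 / (z + c) is the sum of
      \<open>(- c) ^ k * z powi (- k - 1)\<close> over k \<ge> 0; hence only negative indices, and
      the offset by 1.\<close>
    define a where "a k = (if k < 0 then (- c) ^ nat (- k - 1) else 0)" for k :: int
    have g: "fourier_coeff ?g k = a k" for k
    proof (rule fourier_coeff_inverse_shifted_id[OF c])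
      show "a (k - 1) + c * a k = of_bool (k = 0)" for k
      proof (cases "k < 0")
        case True
        then have "nat (- (k - 1) - 1) = Suc (nat (- k - 1))" by simp
        then show ?thesis using True by (simp add: a_def)
      qed (auto simp: a_def)
      show "cmod (a k) \<le> 1" for k
        using True by (auto simp: a_def norm_power intro: power_le_one)
    qed
    define W where "W k = backshift ^^ Suc k" for k
    have W: "bounded_clinear (W k)" "norm (W k x) \<le> norm x" for k x
      unfolding W_def by (intro bounded_clinear_funpow bounded_clinear_backshift norm_backshift_le)+
    have s: "summable (\<lambda>k. cmod ((- c) ^ k))" using True by (simp add: norm_power summable_geometric)
    have "coord (\<Sum>k. (- c) ^ k *\<^sub>C W k (basis_vec n)) m = a (int m - int n)" for m n
    proof -
      \<comment> \<open>Coordinate m of \<open>W k (basis_vec n)\<close> is nonzero only for m + k +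
        1 = n, so at most one term survives.\<close>
      have "(\<Sum>k. (- c) ^ k * coord (W k (basis_vec n)) m)
          = (\<Sum>k\<in>(if m < n then {n - m - 1} else {}). (- c) ^ k * coord (W k (basis_vec n)) m)"
        by (rule suminf_finite) (auto simp: W_def coord_funpow_backshift basis_vec.rep_eq
            simp del: funpow.simps split: if_splits)
      also have "\<dots> = a (int m - int n)"
        by (auto simp: W_def a_def coord_funpow_backshift basis_vec.rep_eq nat_diff_distrib
            simp del: funpow.simps intro!: arg_cong[of _ _ "\<lambda>k. _ ^ k"])
      finally show ?thesis by (simp add: bounded_clinear_series(2)[OF W s])
    qed
    then show ?thesis using bounded_clinear_series(1)[OF W s] True
      by (intro exI[of _ "\<lambda>x. \<Sum>k. (- c) ^ k *\<^sub>C W k x"]) (simp add: g a_def)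
  next
    case False
    then have c1: "cmod c > 1" "c \<noteq> 0" using c by auto
    \<comment> \<open>Now z / c is small, and the expansion is 1 / c times the geometric series in -
      z / c, with nonnegative indices only.\<close>
    define a where "a k = (if k < 0 then 0 else inverse c * (- inverse c) ^ nat k)" for k :: int
    have ic: "cmod (inverse c) < 1" using c1 by (simp add: norm_inverse inverse_less_1_iff)
    have g: "fourier_coeff ?g k = a k" for k
    proof (rule fourier_coeff_inverse_shifted_id[OF c])
      show "a (k - 1) + c * a k = of_bool (k = 0)" for k
      proof (cases "k > 0")
        case True
        then have "nat k = Suc (nat (k - 1))" by simp
        then show ?thesis using True c1 by (simp add: a_def field_simps)
      qed (use c1 in \<open>auto simp: a_def\<close>)
      show "cmod (a k) \<le> 1" for k
        using ic by (auto simp: a_def norm_mult norm_power intro!: mult_le_one power_le_one)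
    qed
    define W where "W k = shift ^^ k" for k
    have W: "bounded_clinear (W k)" "norm (W k x) \<le> norm x" for k x
      unfolding W_def by (intro bounded_clinear_funpow bounded_clinear_shift; simp add: norm_shift)+
    define b where "b k = inverse c * (- inverse c) ^ k" for k
    have s: "summable (\<lambda>k. cmod (b k))"
      using ic by (simp add: b_def norm_mult norm_power summable_geometric summable_mult)
    have "coord (\<Sum>k. b k *\<^sub>C W k (basis_vec n)) m = a (int m - int n)" for m n
    proof -
      have "(\<Sum>k. b k * coord (W k (basis_vec n)) m)
          = (\<Sum>k\<in>(if n \<le> m then {m - n} else {}). b k * coord (W k (basis_vec n)) m)"
        by (rule suminf_finite) (auto simp: W_def funpow_shift_basis_vec basis_vec.rep_eq
            split: if_splits)
      also have "\<dots> = a (int m - int n)"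
        by (auto simp: W_def a_def b_def funpow_shift_basis_vec basis_vec.rep_eq nat_diff_distrib)
      finally show ?thesis by (simp add: bounded_clinear_series(2)[OF W s])
    qed
    then show ?thesis using bounded_clinear_series(1)[OF W s] False
      by (intro exI[of _ "\<lambda>x. \<Sum>k. b k *\<^sub>C W k x"]) (simp add: g a_def)
  qed
  then obtain A where A: "bounded_clinear A"
    "\<And>m n. coord (A (basis_vec n)) m = fourier_coeff ?g (int m - int n)"
    "fourier_coeff ?g (- 1) = of_bool (cmod c < 1)" by blast
  with toeplitz_eqI[OF A(1,2)] show "bounded_clinear (toeplitz ?g)"
    "coord (toeplitz ?g (basis_vec n)) m = fourier_coeff ?g (int m - int n)"
    "fourier_coeff ?g (- 1) = of_bool (cmod c < 1)" by simp_all
qed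

text \<open>The diagonal entries of \<open>[U, T]\<close> are differences of consecutive diagonal entries of \<open>T\<close>
  next to the main diagonal. For a Toeplitz operator only the first one survives.\<close>

lemma omega_shifted_id:
  assumes c: "cmod c \<noteq> 1"
  shows "omega j (toeplitz (\<lambda>z. z + c)) (toeplitz (\<lambda>z. 1 / (z + c)))
    = (if j = 0 then - of_bool (cmod c < 1) else 0)"
proof -
  define Y where "Y = toeplitz (\<lambda>z. 1 / (z + c))"
  note Y = toeplitz_inverse_shifted_id[OF c, folded Y_def]
  have "Y (x + y) = Y x + Y y" "Y (a *\<^sub>C x) = a *\<^sub>C Y x" for x y a
    using Y(1) by (auto simp: bounded_clinear_def linear_add[OF bounded_linear.linear])
  then show ?thesis
    unfolding toeplitz_shifted_id Y_def[symmetric]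
    \<comment> \<open>The part c I commutes with everything. For j = 0 the term with the shift on
      the left has coordinate 0 and drops out; for j > 0 the two terms are the same Toeplitz entry
      and cancel.\<close>
    by (cases j) (simp_all add: omega_def commutator_def cinner_basis_vec_left coord_simps
        shift_basis_vec Y(2,3))
qed

section \<open>Winding number\<close>

text \<open>The image curve is the unit circle about c, so the integral is its winding number about
  0: the origin lies inside for |c| < 1, and outside the closed disc for |c| > 1.\<close>

lemma wind_shifted_id:
  assumes "cmod c \<noteq> 1"
  shows "wind (\<lambda>z. z + c) = of_bool (cmod c < 1)"
proof -
  have path: "(\<lambda>z. z + c) \<circ> circlepath 0 1 = circlepath c 1"
    by (auto simp: circlepath_def part_circlepath_def)
  have "0 \<notin> path_image (circlepath c 1)" using assms by (simp add: sphere_def)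
  then have "wind (\<lambda>z. z + c) = winding_number (circlepath c 1) 0"
    by (simp add: wind_def path winding_number_valid_path)
  also have "\<dots> = of_bool (cmod c < 1)"
  proof (cases "cmod c < 1")
    case False
    then have "winding_number (circlepath c 1) 0 = 0"
      using assms by (intro winding_number_zero_outside[where s = "cball c 1"]) (auto simp: sphere_def)
    then show ?thesis using False by simp
  qed (simp add: winding_number_circlepath)
  finally show ?thesis .
qed

theorem theorem4p7:
  fixes \<epsilon> :: "nat \<Rightarrow> complex" and c :: complex
  assumes "bounded (range \<epsilon>)" and "\<epsilon> \<longlonglongrightarrow> c" and "cmod c \<noteq> 1"
  shows "fredholm (perturbed_shift \<epsilon>)
    \<and> has_symbol (perturbed_shift \<epsilon>) (\<lambda>z. z + c)
    \<and> fredholm_index (perturbed_shift \<epsilon>) = fredholm_index (\<lambda>v. shift v + c *\<^sub>C v)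
    \<and> fredholm_index (\<lambda>v. shift v + c *\<^sub>C v) = - (if cmod c < 1 then 1 else 0)
    \<and> complex_of_int (fredholm_index (perturbed_shift \<epsilon>)) = - wind (\<lambda>z. z + c)
    \<and> (\<lambda>j. omega j (toeplitz (\<lambda>z. z + c)) (toeplitz (\<lambda>z. 1 / (z + c)))) sums
        complex_of_int (fredholm_index (perturbed_shift \<epsilon>))
    \<and> (\<forall>\<delta>. bounded (range \<delta>) \<and> \<delta> \<longlonglongrightarrow> c \<longrightarrow>
        fredholm_index (perturbed_shift \<delta>) = fredholm_index (perturbed_shift \<epsilon>))
    \<and> (cmod c < 1 \<longrightarrow> fredholm_index (perturbed_shift \<epsilon>) = - 1)
    \<and> (cmod c > 1 \<longrightarrow> fredholm_index (perturbed_shift \<epsilon>) = 0)"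
proof -
  have index: "fredholm_index (perturbed_shift \<delta>) = - (if cmod c < 1 then 1 else 0)"
    if "bounded (range \<delta>) \<and> \<delta> \<longlonglongrightarrow> c" for \<delta>
    using that kernels_perturbed_shift(3) assms(3) by blast
  have const: "fredholm_index (\<lambda>v. shift v + c *\<^sub>C v) = - (if cmod c < 1 then 1 else 0)"
    using index[of "\<lambda>_. c"] by (simp add: perturbed_shift_const)
  \<comment> \<open>The shift cancels, leaving a diagonal operator whose entries tend to 0, hence a
    compact one.\<close>
  have "(\<lambda>v. perturbed_shift \<epsilon> v - toeplitz (\<lambda>z. z + c) v) = diag_operator (\<lambda>n. \<epsilon> n - c)"
  proof (intro ext ell2_eqI)
    have "bounded (range (\<lambda>n. \<epsilon> n - c))"
      using assms(1) by (rule bounded_minus_comp) simp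
    then show "coord (perturbed_shift \<epsilon> v - toeplitz (\<lambda>z. z + c) v) n
        = coord (diag_operator (\<lambda>n. \<epsilon> n - c) v) n" for v n
      by (simp add: toeplitz_shifted_id perturbed_shift_def coord_simps coord_diag_operator assms
          algebra_simps)
  qed
  then have symbol: "has_symbol (perturbed_shift \<epsilon>) (\<lambda>z. z + c)"
    using compact_diag_operator[of "\<lambda>n. \<epsilon> n - c"] assms(2)
    by (simp add: has_symbol_def bounded_clinear_perturbed_shift assms(1) LIM_zero)
  have "(\<lambda>j. omega j (toeplitz (\<lambda>z. z + c)) (toeplitz (\<lambda>z. 1 / (z + c)))) sums
      (- of_bool (cmod c < 1))"
    using sums_single[of 0 "\<lambda>_. - of_bool (cmod c < 1) :: complex"]
    by (simp add: omega_shifted_id[OF assms(3)])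
  then show ?thesis
    using index const symbol fredholm_perturbed_shift[OF assms] assms
    by (cases "cmod c < 1") (simp_all add: wind_shifted_id)
qed

end
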